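(* Let $\mathrm{Pol}:\mathcal{T}^\#\to\mathbb{N}[\mathcal{V}]$ be a multilinear polynomial interpretation, let $(\mathcal{I},\mathcal{P})$ be a basic ADP problem, and let $\mathcal{P}=\mathcal{P}_{\ge}\uplus\mathcal{P}_{>}$ with $\mathcal{P}_{>}\ne\emptyset$ such that: (1) for every $\ell\to\{p_1:r_1,\dots,p_k:r_k\}^m\in\mathcal{P}$: $\mathrm{Pol}(\ell^\#)\ge\sum_{1\le j\le k}p_j\cdot\mathcal{S}um(r_j)$; (2) for every $\ell\to\{p_1:r_1,\dots,p_k:r_k\}^m\in\mathcal{P}_{>}$ there is a $j\in\{1,\dots,k\}$ with $\mathrm{Pol}(\ell^\#)>\mathcal{S}um(r_j)$, and if $m=\mathsf{true}$, then additionally (for this $j$) $\mathrm{Pol}(\ell)\ge\mathrm{Pol}(\flat(r_j))$; (3) for every $\ell\to\{p_1:r_1,\dots,p_k:r_k\}^{\mathsf{true}}\in\mathcal{P}$: $\mathrm{Pol}(\ell)\ge\sum_{1\le j\le k}p_j\cdot\mathrm{Pol}(\flat(r_j))$. Then the processor $\mathrm{Proc}_{\mathtt{RP}}(\mathcal{I},\mathcal{P})=\{(\mathcal{I}\cup\mathcal{P}_{>},\ \mathcal{P}_{\ge}\cup\flat(\mathcal{P}_{>}))\}$ is sound and complete for $\mathtt{bAST}$. That is, $(\mathcal{I},\mathcal{P})$ is $\mathtt{bAST}$ if and only if $(\mathcal{I}\cup\mathcal{P}_{>},\ \mathcal{P}_{\ge}\cup\flat(\mathcal{P}_{>}))$ is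 $\mathtt{bAST}$.
   Context: **Terms and annotations.** $\Sigma$ is a finite signature, $\mathcal{V}$ a set of variables, $\mathcal{T}=\mathcal{T}(\Sigma,\mathcal{V})$. $\mathcal{D}\subseteq\Sigma$ is the set of defined symbols, i.e., root symbols of left-hand sides of the ADPs under consideration (those in $\mathcal{I}\cup\mathcal{P}$), and $\mathcal{C}=\Sigma\setminus\mathcal{D}$. A term is basic if it has the form $f(t_1,\dots,t_n)$ with $f\in\mathcal{D}$ and all $t_i\in\mathcal{T}(\mathcal{C},\mathcal{V})$. $\mathrm{Pos}(t)$, $t|_\pi$, $t[r]_\pi$ denote positions, subterm, replacement. A substitution is $\sigma:\mathcal{V}\to\mathcal{T}$ with $\sigma(x)=x$ for all but finitely many $x$. For each $f\in\mathcal{D}$ let $f^\#$ be a fresh symbol of the same arity; $\mathcal{D}^\#=\{f^\#\mid f\in\mathcal{D}\}$, $\Sigma^\#=\Sigma\uplus\mathcal{D}^\#$, $\mathcal{T}^\#=\mathcal{T}(\Sigma^\#,\mathcal{V})$. For $t=f(t_1,\dots,t_n)\in\mathcal{T}$ with $f\in\mathcal{D}$, $t^\#=f^\#(t_1,\dots,t_n)$. $\mathrm{Pos}_X(t)$ is the set of positions of $t$ carrying a symbol or variable from $X$. For $\Phi\subseteq\mathrm{Pos}_{\mathcal{D}\cup\mathcal{D}^\#}(t)$, $\#_\Phi(t)$ is the variant of $t$ where exactly the symbols at positions in $\Phi$ are annotated (all other annotations removed); $\flat(t)=\#_\emptyset(t)$. $\flat^\uparrow_\pi(t)$ results from $t$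 by removing all annotations strictly above $\pi$. **Polynomial interpretations.** A polynomial interpretation $\mathrm{Pol}$ maps every $f\in\Sigma^\#$ of arity $n$ to an $n$-ary polynomial $f_{\mathrm{Pol}}$ with coefficients in $\mathbb{N}$, and is extended to terms by $\mathrm{Pol}(x)=x$ for variables and $\mathrm{Pol}(f(t_1,\dots,t_n))=f_{\mathrm{Pol}}(\mathrm{Pol}(t_1),\dots,\mathrm{Pol}(t_n))$. It is multilinear if all monomials of all $f_{\mathrm{Pol}}(x_1,\dots,x_n)$ have the form $c\cdot x_1^{e_1}\cdots x_n^{e_n}$ with $c\in\mathbb{N}$ and $e_1,\dots,e_n\in\{0,1\}$. Inequations between polynomials hold if they are true for all instantiations of the variables by natural numbers. For $r\in\mathcal{T}^\#$, $\mathcal{S}um(r)=\sum_{\pi\in\mathrm{Pos}_{\mathcal{D}^\#}(r)}\mathrm{Pol}\big((\flat(r|_\pi))^\#\big)$ (the sum over all annotated subterm occurrences of $r$). **ADPs.** An annotated dependency pair (ADP) has the form $\ell\to\{p_1:r_1,\dots,p_k:r_k\}^m$ with $\ell\in\mathcal{T}\setminus\mathcal{V}$, $m\in\{\mathsf{true},\mathsf{false}\}$, $r_j\in\mathcal{T}^\#$, all variables of $r_j$ occurring in $\ell$, probabilities $p_j\in(0,1]$ summing to $1$. For a set $X$ of ADPs, $\flat(X)$ is $X$ with all annotations removed from all right-hand sides (flags kept). **Rewriting with ADPs.** A variable reposition function (VRF) for an ADP $\ell\to\{p_1:r_1,\dots,p_k:r_k\}^m$ is a family of functions $\varphi_j:\mathrm{Pos}_{\mathcal{V}}(\ell)\to\mathrm{Pos}_{\mathcal{V}}(r_j)\uplus\{\bot\}$,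 $1\le j\le k$, with $\ell|_\rho=r_j|_{\varphi_j(\rho)}$ whenever $\varphi_j(\rho)\ne\bot$. For a finite set $\mathcal{P}$ of ADPs, a term $s\in\mathcal{T}^\#$ rewrites with $\mathcal{P}$ to $\{p_1:t_1,\dots,p_k:t_k\}$ (written $s\hookrightarrow_{\mathcal{P}}\{p_1:t_1,\dots,p_k:t_k\}$) if there are an ADP $\ell\to\{p_1:r_1,\dots,p_k:r_k\}^m\in\mathcal{P}$, a VRF $(\varphi_j)_j$ for it, a substitution $\sigma$ and $\pi\in\mathrm{Pos}_{\mathcal{D}\cup\mathcal{D}^\#}(s)$ with $\flat(s|_\pi)=\ell\sigma$, such that for all $j$: - (at) $t_j=s[\#_{\Phi_j}(r_j\sigma)]_\pi$ if $\pi\in\mathrm{Pos}_{\mathcal{D}^\#}(s)$ and $m=\mathsf{true}$; - (af) $t_j=\flat^\uparrow_\pi(s[\#_{\Phi_j}(r_j\sigma)]_\pi)$ if $\pi\in\mathrm{Pos}_{\mathcal{D}^\#}(s)$ and $m=\mathsf{false}$; - (nt) $t_j=s[\#_{\Psi_j}(r_j\sigma)]_\pi$ if $\pi\notin\mathrm{Pos}_{\mathcal{D}^\#}(s)$ and $m=\mathsf{true}$. (There is no step if $\pi\notin\mathrm{Pos}_{\mathcal{D}^\#}(s)$ and $m=\mathsf{false}$.) Here $\Psi_j=\{\varphi_j(\rho).\tau\mid\rho\in\mathrm{Pos}_{\mathcal{V}}(\ell),\ \varphi_j(\rho)\ne\bot,\ \rho.\tau\in\mathrm{Pos}_{\mathcal{D}^\#}(s|_\pi)\}$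 and $\Phi_j=\mathrm{Pos}_{\mathcal{D}^\#}(r_j)\cup\Psi_j$. **Chain trees and bAST.** A $\mathcal{P}$-chain tree (CT) is $\mathfrak{T}=(V,E,L,A)$ where $(V,E)$ is a non-empty, possibly infinite, finitely branching directed tree; $L$ labels each node $v$ by a probability $p_v\in(0,1]$ and a term $t_v\in\mathcal{T}^\#$, with $p_v=1$ for the root; $A$ is a subset of the inner nodes; for each inner node $v$ with successors $w_1,\dots,w_k$, $t_v\hookrightarrow_{\mathcal{P}}\{\frac{p_{w_1}}{p_v}:t_{w_1},\dots,\frac{p_{w_k}}{p_v}:t_{w_k}\}$ using case (at) or (af) if $v\in A$ and another case if $v\notin A$; and every infinite path contains infinitely many nodes from $A$. $|\mathfrak{T}|_{\mathrm{Leaf}}$ is the sum of $p_v$ over all leaves $v$. A basic ADP problem is a pair $(\mathcal{I},\mathcal{P})$ of finite sets of ADPs; it is $\mathtt{bAST}$ if $|\mathfrak{T}|_{\mathrm{Leaf}}=1$ for all those $(\mathcal{I}\cup\mathcal{P})$-CTs $\mathfrak{T}$ whose root term is $t^\#$ for a basic term $t\in\mathcal{T}$ and in which ADPs from $\mathcal{I}\setminus\mathcal{P}$ are used only finitely often within the whole tree. **Processors.** A processor maps a basic ADP problem to a finite set of basic ADP problems. It is sound for $\mathtt{bAST}$ if the input is $\mathtt{bAST}$ whenever all resulting problems are, and complete if all resulting problems are $\mathtt{bAST}$ whenever the input is. *)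

theory Defs
  imports
    "HOL-Analysis.Infinite_Sum"
    "HOL-Library.Multiset"
    "HOL-Library.Poly_Mapping"
    "HOL-Library.Sublist"
begin

section \<open>Annotated terms\<close>

text \<open>
  The signature is the type \<open>'f\<close> with arities \<open>ar :: 'f \<Rightarrow> nat\<close>, the variables are the type \<open>'v\<close>.
  \<open>Sharp f\<close> is the annotated copy of \<open>f\<close>. Annotated and unannotated terms share one
  type; membership in \<open>\<T>\<close> or \<open>\<T>\<^sup>#\<close> is a predicate.
\<close>

datatype 'f sym = Plain (base: 'f) | Sharp (base: 'f)

datatype ('g, 'v) trm = Var 'v | Fun 'g "('g, 'v) trm list"

type_synonym ('f, 'v) atrm = "('f sym, 'v) trm"

inductive_set terms_over :: "('f \<Rightarrow> nat) \<Rightarrow> 'f sym set \<Rightarrow> ('f, 'v) atrm set"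
  for ar :: "'f \<Rightarrow> nat" and G :: "'f sym set" where
  Var: "Var x \<in> terms_over ar G"
| Fun: "g \<in> G \<Longrightarrow> length ts = ar (base g) \<Longrightarrow> (\<forall>t\<in>set ts. t \<in> terms_over ar G) \<Longrightarrow>
    Fun g ts \<in> terms_over ar G"

definition sharp_sig :: "'f set \<Rightarrow> 'f sym set" where
  "sharp_sig D = range Plain \<union> Sharp ` D"

definition plain_terms :: "('f \<Rightarrow> nat) \<Rightarrow> ('f, 'v) atrm set" where
  "plain_terms ar = terms_over ar (range Plain)"

definition sharp_terms :: "('f \<Rightarrow> nat) \<Rightarrow> 'f set \<Rightarrow> ('f, 'v) atrm set" where
  "sharp_terms ar D = terms_over ar (sharp_sig D)"

definition basic_term :: "('f \<Rightarrow> nat) \<Rightarrow> 'f set \<Rightarrow> ('f, 'v) atrm \<Rightarrow> bool" where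
  "basic_term ar D t \<longleftrightarrow> (\<exists>f ts. t = Fun (Plain f) ts \<and> f \<in> D \<and> length ts = ar f \<and>
     (\<forall>u\<in>set ts. u \<in> terms_over ar (Plain ` (- D))))"

fun vars :: "('g, 'v) trm \<Rightarrow> 'v set" where
  "vars (Var x) = {x}"
| "vars (Fun g ts) = (\<Union>t\<in>set ts. vars t)"

fun subst :: "('v \<Rightarrow> ('g, 'v) trm) \<Rightarrow> ('g, 'v) trm \<Rightarrow> ('g, 'v) trm" where
  "subst \<sigma> (Var x) = \<sigma> x"
| "subst \<sigma> (Fun g ts) = Fun g (map (subst \<sigma>) ts)"

definition is_subst :: "('f \<Rightarrow> nat) \<Rightarrow> ('v \<Rightarrow> ('f, 'v) atrm) \<Rightarrow> bool" where
  "is_subst ar \<sigma> \<longleftrightarrow> (\<forall>x. \<sigma> x \<in> plain_terms ar) \<and> finite {x. \<sigma> x \<noteq> Var x}"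

text \<open>Positions are lists of argument indices, counted from 0.\<close>

type_synonym pos = "nat list"

lemma size_nth_less: "i < length ts \<Longrightarrow> size (ts ! i) < Suc (size_list size ts)"
  by (simp add: less_Suc_eq_le size_list_estimation'[OF nth_mem order_refl])

function (sequential) poss :: "('g, 'v) trm \<Rightarrow> pos set" where
  "poss (Var x) = {[]}"
| "poss (Fun g ts) = insert [] (\<Union>i\<in>{..<length ts}. (#) i ` poss (ts ! i))"
  by pat_completeness auto
termination
  by (relation "measure size") (auto intro: size_nth_less)

fun subt_at :: "('g, 'v) trm \<Rightarrow> pos \<Rightarrow> ('g, 'v) trm" where
  "subt_at t [] = t"
| "subt_at (Fun g ts) (i # p) = subt_at (ts ! i) p"

fun replace_at :: "('g, 'v) trm \<Rightarrow> pos \<Rightarrow> ('g, 'v) trm \<Rightarrow> ('g, 'v) trm" where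
  "replace_at t [] u = u"
| "replace_at (Fun g ts) (i # p) u = Fun g (ts[i := replace_at (ts ! i) p u])"

definition var_poss :: "('g, 'v) trm \<Rightarrow> pos set" where
  "var_poss t = {p \<in> poss t. \<exists>x. subt_at t p = Var x}"

definition sym_poss :: "'g set \<Rightarrow> ('g, 'v) trm \<Rightarrow> pos set" where
  "sym_poss G t = {p \<in> poss t. \<exists>g ts. subt_at t p = Fun g ts \<and> g \<in> G}"

abbreviation sharp_poss :: "'f set \<Rightarrow> ('f, 'v) atrm \<Rightarrow> pos set" where
  "sharp_poss D \<equiv> sym_poss (Sharp ` D)"

abbreviation defined_poss :: "'f set \<Rightarrow> ('f, 'v) atrm \<Rightarrow> pos set" where
  "defined_poss D \<equiv> sym_poss (Plain ` D \<union> Sharp ` D)"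

text \<open>\<open>annot \<Phi> t\<close> is $\#_\Phi(t)$; it also erases every annotation of \<open>t\<close> outside \<open>\<Phi>\<close>.\<close>

function (sequential) annot :: "pos set \<Rightarrow> ('f, 'v) atrm \<Rightarrow> ('f, 'v) atrm" where
  "annot \<Phi> (Var x) = Var x"
| "annot \<Phi> (Fun g ts) = Fun (if [] \<in> \<Phi> then Sharp (base g) else Plain (base g))
     (map (\<lambda>i. annot {p. i # p \<in> \<Phi>} (ts ! i)) [0..<length ts])"
  by pat_completeness auto
termination
  by (relation "measure (size \<circ> snd)") (auto intro: size_nth_less)

abbreviation flat :: "('f, 'v) atrm \<Rightarrow> ('f, 'v) atrm" where
  "flat t \<equiv> annot {} t"

definition flat_above :: "'f set \<Rightarrow> pos \<Rightarrow> ('f, 'v) atrm \<Rightarrow> ('f, 'v) atrm" where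
  "flat_above D \<pi> t = annot {p \<in> sharp_poss D t. \<not> strict_prefix p \<pi>} t"

fun sharp :: "('f, 'v) atrm \<Rightarrow> ('f, 'v) atrm" where
  "sharp (Fun g ts) = Fun (Sharp (base g)) ts"
| "sharp (Var x) = Var x"


section \<open>Polynomial interpretations\<close>

text \<open>
  \<open>'x mpoly\<close> is $\mathbb{N}[X]$ for the indeterminates \<open>'x\<close>; a monomial is its finitely supported
  exponent function. \<open>peval p \<theta>\<close> replaces every indeterminate \<open>x\<close> of \<open>p\<close> by \<open>\<theta> x\<close>. With values in
  \<open>'v mpoly\<close> this is composition of polynomials, with values in \<open>nat\<close> it is evaluation.
\<close>

type_synonym 'x mpoly = "('x \<Rightarrow>\<^sub>0 nat) \<Rightarrow>\<^sub>0 nat"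

definition pvar :: "'x \<Rightarrow> 'x mpoly" where
  "pvar x = Poly_Mapping.single (Poly_Mapping.single x 1) 1"

definition peval :: "'x mpoly \<Rightarrow> ('x \<Rightarrow> 'a::comm_semiring_1) \<Rightarrow> 'a" where
  "peval p \<theta> = (\<Sum>m\<in>Poly_Mapping.keys p. of_nat (Poly_Mapping.lookup p m) *
     (\<Prod>x\<in>Poly_Mapping.keys m. \<theta> x ^ Poly_Mapping.lookup m x))"

text \<open>The indeterminates of an \<open>n\<close>-ary polynomial are the argument indices \<open>0, \<dots>, n - 1\<close>.\<close>

definition nary :: "nat \<Rightarrow> nat mpoly \<Rightarrow> bool" where
  "nary n p \<longleftrightarrow> (\<forall>m\<in>Poly_Mapping.keys p. Poly_Mapping.keys m \<subseteq> {..<n})"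

definition poly_interp :: "('f \<Rightarrow> nat) \<Rightarrow> 'f set \<Rightarrow> ('f sym \<Rightarrow> nat mpoly) \<Rightarrow> bool" where
  "poly_interp ar D Pol \<longleftrightarrow> (\<forall>g\<in>sharp_sig D. nary (ar (base g)) (Pol g))"

definition multilinear :: "'f set \<Rightarrow> ('f sym \<Rightarrow> nat mpoly) \<Rightarrow> bool" where
  "multilinear D Pol \<longleftrightarrow> (\<forall>g\<in>sharp_sig D. \<forall>m\<in>Poly_Mapping.keys (Pol g). \<forall>i. Poly_Mapping.lookup m i \<in> {0, 1})"

fun pol :: "('f sym \<Rightarrow> nat mpoly) \<Rightarrow> ('f, 'v) atrm \<Rightarrow> 'v mpoly" where
  "pol Pol (Var x) = pvar x"
| "pol Pol (Fun g ts) = peval (Pol g) (\<lambda>i. map (pol Pol) ts ! i)"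

definition Sum_pol :: "'f set \<Rightarrow> ('f sym \<Rightarrow> nat mpoly) \<Rightarrow> ('f, 'v) atrm \<Rightarrow> 'v mpoly" where
  "Sum_pol D Pol r = (\<Sum>\<pi>\<in>sharp_poss D r. pol Pol (sharp (flat (subt_at r \<pi>))))"


section \<open>Annotated dependency pairs\<close>

text \<open>
  As the branches of a right-hand side are unordered and may coincide, it is a multiset.
\<close>

datatype ('f, 'v) adp =
  ADP (lhs: "('f, 'v) atrm") (rhs: "(real \<times> ('f, 'v) atrm) multiset") (flag: bool)

definition is_adp :: "('f \<Rightarrow> nat) \<Rightarrow> 'f set \<Rightarrow> ('f, 'v) adp \<Rightarrow> bool" where
  "is_adp ar D \<alpha> \<longleftrightarrow>
     lhs \<alpha> \<in> plain_terms ar \<and> (\<nexists>x. lhs \<alpha> = Var x) \<and>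
     (\<forall>(p, r) \<in># rhs \<alpha>. 0 < p \<and> p \<le> 1 \<and> r \<in> sharp_terms ar D \<and> vars r \<subseteq> vars (lhs \<alpha>)) \<and>
     (\<Sum>(p, r) \<in># rhs \<alpha>. p) = 1"

definition defined_syms :: "('f, 'v) adp set \<Rightarrow> 'f set" where
  "defined_syms X = {f. \<exists>\<alpha>\<in>X. \<exists>ts. lhs \<alpha> = Fun (Plain f) ts}"

definition flat_adp :: "('f, 'v) adp \<Rightarrow> ('f, 'v) adp" where
  "flat_adp \<alpha> = ADP (lhs \<alpha>) {#(p, flat r). (p, r) \<in># rhs \<alpha>#} (flag \<alpha>)"

type_synonym ('f, 'v) problem = "('f, 'v) adp set \<times> ('f, 'v) adp set"

definition basic_adp_problem :: "('f \<Rightarrow> nat) \<Rightarrow> ('f, 'v) problem \<Rightarrow> bool" where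
  "basic_adp_problem ar = (\<lambda>(I, P). finite I \<and> finite P \<and>
     (\<forall>\<alpha>\<in>I \<union> P. is_adp ar (defined_syms (I \<union> P)) \<alpha>))"


section \<open>Rewriting with ADPs\<close>

text \<open>\<open>None\<close> stands for $\bot$; only the values of \<open>\<phi>\<close> on \<open>var_poss l\<close> matter.\<close>

definition is_vrf :: "('f, 'v) atrm \<Rightarrow> ('f, 'v) atrm \<Rightarrow> (pos \<Rightarrow> pos option) \<Rightarrow> bool" where
  "is_vrf l r \<phi> \<longleftrightarrow> (\<forall>\<rho>\<in>var_poss l. \<forall>\<pi>. \<phi> \<rho> = Some \<pi> \<longrightarrow>
     \<pi> \<in> var_poss r \<and> subt_at l \<rho> = subt_at r \<pi>)"

text \<open>\<open>u\<close> is the subterm \<open>s|\<^sub>\<pi>\<close> at which the rewrite step takes place.\<close>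

definition Psi :: "'f set \<Rightarrow> ('f, 'v) atrm \<Rightarrow> ('f, 'v) atrm \<Rightarrow> (pos \<Rightarrow> pos option) \<Rightarrow> pos set" where
  "Psi D l u \<phi> = {\<pi> @ \<tau> | \<pi> \<tau> \<rho>. \<rho> \<in> var_poss l \<and> \<phi> \<rho> = Some \<pi> \<and> \<rho> @ \<tau> \<in> sharp_poss D u}"

definition Phi :: "'f set \<Rightarrow> ('f, 'v) atrm \<Rightarrow> ('f, 'v) atrm \<Rightarrow> ('f, 'v) atrm \<Rightarrow>
    (pos \<Rightarrow> pos option) \<Rightarrow> pos set" where
  "Phi D l r u \<phi> = sharp_poss D r \<union> Psi D l u \<phi>"

datatype step_case = AT | AF | NT

fun case_applies :: "step_case \<Rightarrow> bool \<Rightarrow> bool \<Rightarrow> bool" where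
  "case_applies AT annotated m \<longleftrightarrow> annotated \<and> m"
| "case_applies AF annotated m \<longleftrightarrow> annotated \<and> \<not> m"
| "case_applies NT annotated m \<longleftrightarrow> \<not> annotated \<and> m"

fun result :: "step_case \<Rightarrow> 'f set \<Rightarrow> ('f, 'v) atrm \<Rightarrow> pos \<Rightarrow> ('f, 'v) atrm \<Rightarrow>
    ('v \<Rightarrow> ('f, 'v) atrm) \<Rightarrow> ('f, 'v) atrm \<Rightarrow> (pos \<Rightarrow> pos option) \<Rightarrow> ('f, 'v) atrm" where
  "result AT D s \<pi> l \<sigma> r \<phi> =
     replace_at s \<pi> (annot (Phi D l r (subt_at s \<pi>) \<phi>) (subst \<sigma> r))"
| "result AF D s \<pi> l \<sigma> r \<phi> =
     flat_above D \<pi> (replace_at s \<pi> (annot (Phi D l r (subt_at s \<pi>) \<phi>) (subst \<sigma> r)))"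
| "result NT D s \<pi> l \<sigma> r \<phi> =
     replace_at s \<pi> (annot (Psi D l (subt_at s \<pi>) \<phi>) (subst \<sigma> r))"

text \<open>
  \<open>adp_step ar D \<alpha> c s \<mu>\<close>: the term \<open>s\<close> rewrites to the multi-distribution \<open>\<mu>\<close> with the ADP \<open>\<alpha>\<close>,
  using case \<open>c\<close>. The relation \<open>rel_mset\<close> matches the branches of \<open>\<alpha>\<close> one-to-one with
  those of \<open>\<mu>\<close>; each branch comes with its own member of the family of repositionings.
\<close>

definition adp_step :: "('f \<Rightarrow> nat) \<Rightarrow> 'f set \<Rightarrow> ('f, 'v) adp \<Rightarrow> step_case \<Rightarrow> ('f, 'v) atrm \<Rightarrow>
    (real \<times> ('f, 'v) atrm) multiset \<Rightarrow> bool" where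
  "adp_step ar D \<alpha> c s \<mu> \<longleftrightarrow> (\<exists>\<sigma> \<pi>. is_subst ar \<sigma> \<and> \<pi> \<in> defined_poss D s \<and>
     flat (subt_at s \<pi>) = subst \<sigma> (lhs \<alpha>) \<and>
     case_applies c (\<pi> \<in> sharp_poss D s) (flag \<alpha>) \<and>
     rel_mset (\<lambda>(p, r) (q, t). q = p \<and>
         (\<exists>\<phi>. is_vrf (lhs \<alpha>) r \<phi> \<and> t = result c D s \<pi> (lhs \<alpha>) \<sigma> r \<phi>))
       (rhs \<alpha>) \<mu>)"


section \<open>Chain trees\<close>

definition rooted_tree :: "'n set \<Rightarrow> ('n \<times> 'n) set \<Rightarrow> 'n \<Rightarrow> bool" where
  "rooted_tree V E r \<longleftrightarrow> r \<in> V \<and> E \<subseteq> V \<times> V \<and>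
     (\<forall>u. (u, r) \<notin> E) \<and> (\<forall>u u' v. (u, v) \<in> E \<longrightarrow> (u', v) \<in> E \<longrightarrow> u = u') \<and>
     (\<forall>v\<in>V. (r, v) \<in> E\<^sup>*)"

record ('n, 'f, 'v) chain_tree =
  nodes :: "'n set"
  edges :: "('n \<times> 'n) set"
  prob :: "'n \<Rightarrow> real"
  label :: "'n \<Rightarrow> ('f, 'v) atrm"
  A_nodes :: "'n set"

definition children :: "('n, 'f, 'v) chain_tree \<Rightarrow> 'n \<Rightarrow> 'n set" where
  "children T v = {w. (v, w) \<in> edges T}"

definition leaves :: "('n, 'f, 'v) chain_tree \<Rightarrow> 'n set" where
  "leaves T = {v \<in> nodes T. children T v = {}}"

definition inner :: "('n, 'f, 'v) chain_tree \<Rightarrow> 'n set" where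
  "inner T = {v \<in> nodes T. children T v \<noteq> {}}"

text \<open>
  \<open>is_CT ar D X T used\<close>: \<open>T\<close> is an \<open>X\<close>-chain tree, where \<open>used v\<close> is an ADP justifying the step
  at the inner node \<open>v\<close>. One step may be justified by several ADPs, so \<open>used\<close> is needed to
  talk about how often an ADP is used.
\<close>

definition is_CT :: "('f \<Rightarrow> nat) \<Rightarrow> 'f set \<Rightarrow> ('f, 'v) adp set \<Rightarrow> ('n, 'f, 'v) chain_tree \<Rightarrow>
    ('n \<Rightarrow> ('f, 'v) adp) \<Rightarrow> bool" where
  "is_CT ar D X T used \<longleftrightarrow>
     (\<exists>r. rooted_tree (nodes T) (edges T) r \<and> prob T r = 1) \<and>
     (\<forall>v\<in>nodes T. finite (children T v)) \<and>
     (\<forall>v\<in>nodes T. 0 < prob T v \<and> prob T v \<le> 1 \<and> label T v \<in> sharp_terms ar D) \<and>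
     A_nodes T \<subseteq> inner T \<and>
     (\<forall>v\<in>inner T. used v \<in> X \<and>
        (\<exists>c. (v \<in> A_nodes T \<longleftrightarrow> c \<in> {AT, AF}) \<and>
           adp_step ar D (used v) c (label T v)
             {#(prob T w / prob T v, label T w). w \<in># mset_set (children T v)#})) \<and>
     (\<forall>x :: nat \<Rightarrow> 'n. (\<forall>i. (x i, x (Suc i)) \<in> edges T) \<longrightarrow> infinite {i. x i \<in> A_nodes T})"

definition leaf_prob :: "('n, 'f, 'v) chain_tree \<Rightarrow> real" where
  "leaf_prob T = (\<Sum>\<^sub>\<infinity>v\<in>leaves T. prob T v)"

text \<open>
  A finitely branching tree is countable, so up to isomorphism all chain trees have their nodes
  in \<open>nat\<close>.
\<close>

definition bAST :: "('f \<Rightarrow> nat) \<Rightarrow> ('f, 'v) problem \<Rightarrow> bool" where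
  "bAST ar = (\<lambda>(I, P). let D = defined_syms (I \<union> P) in
     \<forall>(T :: (nat, 'f, 'v) chain_tree) used r t.
       is_CT ar D (I \<union> P) T used \<longrightarrow>
       rooted_tree (nodes T) (edges T) r \<longrightarrow> basic_term ar D t \<longrightarrow> label T r = sharp t \<longrightarrow>
       finite {v \<in> inner T. used v \<in> I - P} \<longrightarrow>
       leaf_prob T = 1)"


section \<open>Processors\<close>

text \<open>Soundness and completeness of a processor that maps the problem \<open>Q\<close> to the set \<open>R\<close>.\<close>

definition sound_bAST :: "('f \<Rightarrow> nat) \<Rightarrow> ('f, 'v) problem \<Rightarrow> ('f, 'v) problem set \<Rightarrow> bool" where
  "sound_bAST ar Q R \<longleftrightarrow> ((\<forall>Q'\<in>R. bAST ar Q') \<longrightarrow> bAST ar Q)"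

definition complete_bAST :: "('f \<Rightarrow> nat) \<Rightarrow> ('f, 'v) problem \<Rightarrow> ('f, 'v) problem set \<Rightarrow> bool" where
  "complete_bAST ar Q R \<longleftrightarrow> (bAST ar Q \<longrightarrow> (\<forall>Q'\<in>R. bAST ar Q'))"

definition proc_RP :: "('f, 'v) adp set \<Rightarrow> ('f, 'v) adp set \<Rightarrow> ('f, 'v) adp set \<Rightarrow>
    ('f, 'v) problem set" where
  "proc_RP I P_ge P_gt = {(I \<union> P_gt, P_ge \<union> flat_adp ` P_gt)}"

lemma sound_complete_proc_RP_iff:
  "sound_bAST ar (I, P) (proc_RP I P_ge P_gt) \<and> complete_bAST ar (I, P) (proc_RP I P_ge P_gt) \<longleftrightarrow>
   (bAST ar (I, P) \<longleftrightarrow> bAST ar (I \<union> P_gt, P_ge \<union> flat_adp ` P_gt))"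
  by (auto simp: sound_bAST_def complete_bAST_def proc_RP_def)

end

theory Submission
  imports Defs
begin

text \<open>
  The weight of a term is the sum of the values of its annotated subterms, with all variables set
  to 0. By multilinearity its expectation does not increase in steps with \<open>P\<close>, and in a step with
  \<open>P_gt\<close> at an annotated position some branch loses at least 1.

  Soundness: beyond some depth a chain tree uses only \<open>P\<close>. Turn every node at depth at least
  \<open>n\<close> that uses \<open>P_gt\<close> at an annotated position into a leaf, and replace the other steps with
  \<open>P_gt\<close> by steps with \<open>flat_adp\<close>. As the new problem is bAST, this tree terminates almost surely
  for every \<open>n\<close>. So if the original tree did not, then with positive probability it would
  use \<open>P_gt\<close> at annotated positions again and again, which the weight forbids.

  Completeness: replacing \<open>flat_adp \<alpha>\<close> by \<open>\<alpha>\<close> only adds annotations, and hence only adds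
  nodes to \<open>A_nodes\<close>, while the probabilities stay the same.
\<close>

section \<open>Composition of polynomials\<close>

text \<open>The obstacle: \<open>cond2\<close> promises a loss in one branch only and
  \<open>cond1\<close> merely keeps the expectation from growing, so the expected weight need not
  drop. The bounded, strictly concave function 1 - 1/(1+x) of the weight does drop in expectation,
  by at least c/(1+x)^3, where c bounds the branch probabilities of \<open>P_gt\<close> from below;
  all drops together are at most 1. As the drop fades for large weights, a Markov bound must keep
  the weight small on a sizeable part of the nodes at which the tree is cut. Stopping each path at
  its first such node makes their masses add up without overlap. The two kinds of conditions on
  values have different tasks. Annotated subterms above the redex depend affinely on the value of
  the unannotated redex, which \<open>cond3\<close> controls; the annotation of the redex itself and
  those brought in by the right-hand side are controlled by \<open>cond1\<close>. A flag
  \<open>False\<close> allows only case \<open>AF\<close>, which erases the annotations above the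
  redex and with them the affine part.\<close>

definition meval :: "('x \<Rightarrow>\<^sub>0 nat) \<Rightarrow> ('x \<Rightarrow> 'a::comm_semiring_1) \<Rightarrow> 'a" where
  "meval m \<theta> = (\<Prod>x\<in>Poly_Mapping.keys m. \<theta> x ^ Poly_Mapping.lookup m x)"

lemma peval_eq_meval:
  "peval p \<theta> = (\<Sum>m\<in>Poly_Mapping.keys p. of_nat (Poly_Mapping.lookup p m) * meval m \<theta>)"
  by (simp add: peval_def meval_def)

lemma meval_superset:
  assumes "finite S" "Poly_Mapping.keys m \<subseteq> S"
  shows "meval m \<theta> = (\<Prod>x\<in>S. \<theta> x ^ Poly_Mapping.lookup m x)"
  unfolding meval_def using assms
  by (intro prod.mono_neutral_left) (auto simp: in_keys_iff)

lemma meval_add: "meval (m + n) \<theta> = meval m \<theta> * meval n \<theta>"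
proof -
  let ?S = "Poly_Mapping.keys m \<union> Poly_Mapping.keys n"
  have "meval (m + n) \<theta> = (\<Prod>x\<in>?S. \<theta> x ^ Poly_Mapping.lookup (m + n) x)"
    by (rule meval_superset) (use Poly_Mapping.keys_add[of m n] in auto)
  also have "\<dots> = (\<Prod>x\<in>?S. \<theta> x ^ Poly_Mapping.lookup m x) * (\<Prod>x\<in>?S. \<theta> x ^ Poly_Mapping.lookup n x)"
    by (simp add: lookup_add power_add prod.distrib)
  also have "\<dots> = meval m \<theta> * meval n \<theta>"
    using meval_superset[of ?S m \<theta>] meval_superset[of ?S n \<theta>] by simp
  finally show ?thesis .
qed

lemma peval_superset:
  assumes "finite S" "Poly_Mapping.keys p \<subseteq> S"
  shows "peval p \<theta> = (\<Sum>m\<in>S. of_nat (Poly_Mapping.lookup p m) * meval m \<theta>)"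
  unfolding peval_eq_meval using assms
  by (intro sum.mono_neutral_left) (auto simp: in_keys_iff)

lemma peval_single: "peval (Poly_Mapping.single m c) \<theta> = of_nat c * meval m \<theta>"
  by (subst peval_superset[of "{m}"]) auto

lemma peval_0 [simp]: "peval 0 \<theta> = 0"
  by (simp add: peval_def)

lemma peval_1 [simp]: "peval 1 \<theta> = 1"
  using peval_single[of 0 1 \<theta>] by (simp add: meval_def single_one del: One_nat_def)

lemma peval_pvar [simp]: "peval (pvar x) \<theta> = \<theta> x"
  unfolding pvar_def peval_single by (simp add: meval_def)

lemma peval_add: "peval (p + q) \<theta> = peval p \<theta> + peval q \<theta>"
proof -
  let ?S = "Poly_Mapping.keys p \<union> Poly_Mapping.keys q"
  have "peval (p + q) \<theta> = (\<Sum>m\<in>?S. of_nat (Poly_Mapping.lookup (p + q) m) * meval m \<theta>)"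
    by (rule peval_superset) (use Poly_Mapping.keys_add[of p q] in auto)
  also have "\<dots> = (\<Sum>m\<in>?S. of_nat (Poly_Mapping.lookup p m) * meval m \<theta>) +
      (\<Sum>m\<in>?S. of_nat (Poly_Mapping.lookup q m) * meval m \<theta>)"
    by (simp add: lookup_add sum.distrib algebra_simps)
  also have "\<dots> = peval p \<theta> + peval q \<theta>"
    using peval_superset[of ?S p \<theta>] peval_superset[of ?S q \<theta>] by simp
  finally show ?thesis .
qed

lemma peval_sum: "peval (sum f A) \<theta> = (\<Sum>a\<in>A. peval (f a) \<theta>)"
  by (induction A rule: infinite_finite_induct) (auto simp: peval_add)

lemma poly_mapping_sum_single:
  fixes p :: "'a \<Rightarrow>\<^sub>0 'b::comm_monoid_add"
  shows "p = (\<Sum>m\<in>Poly_Mapping.keys p. Poly_Mapping.single m (Poly_Mapping.lookup p m))"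
  by (rule poly_mapping_eqI)
     (auto simp: lookup_sum lookup_single when_def in_keys_iff)

lemma peval_mult: "peval (p * q) \<theta> = peval p \<theta> * peval q \<theta>"
proof -
  \<comment> \<open>Both factors are expanded into single terms, which reduces the claim to
    monomials, i.e. to \<open>meval_add\<close>.\<close>
  have "p * q = (\<Sum>m\<in>Poly_Mapping.keys p. \<Sum>n\<in>Poly_Mapping.keys q.
      Poly_Mapping.single (m + n) (Poly_Mapping.lookup p m * Poly_Mapping.lookup q n))"
    by (subst poly_mapping_sum_single[of p], subst poly_mapping_sum_single[of q])
       (simp add: sum_product mult_single)
  then show ?thesis
    by (simp add: peval_sum peval_single meval_add peval_eq_meval[of p] peval_eq_meval[of q]
        sum_product algebra_simps)
qed

lemma peval_power: "peval (p ^ n) \<theta> = peval p \<theta> ^ n"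
  by (induction n) (auto simp: peval_mult)

lemma peval_prod: "peval (prod f A) \<theta> = (\<Prod>a\<in>A. peval (f a) \<theta>)"
  by (induction A rule: infinite_finite_induct) (auto simp: peval_mult)

lemma peval_of_nat: "peval (of_nat n) \<theta> = of_nat n"
  by (induction n) (auto simp: peval_add)

text \<open>\<open>peval p\<close> is built from sums, products, powers and numerals, and evaluation
  respects all of these. With numeric \<open>\<rho>\<close> this turns the composed polynomials of
  \<open>pol\<close> into arithmetic on numbers.\<close>

lemma peval_peval: "peval (peval p \<theta>) \<rho> = peval p (\<lambda>i. peval (\<theta> i) \<rho>)"
  unfolding peval_def[of p] by (simp add: peval_sum peval_mult peval_prod peval_power peval_of_nat)

lemma peval_cong:
  assumes "\<And>m x. m \<in> Poly_Mapping.keys p \<Longrightarrow> x \<in> Poly_Mapping.keys m \<Longrightarrow> \<theta> x = \<theta>' x"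
  shows "peval p \<theta> = peval p \<theta>'"
  unfolding peval_def using assms by (intro sum.cong refl arg_cong2[of _ _ _ _ "(*)"] prod.cong) auto

text \<open>\<open>pol\<close> looks up arguments with \<open>!\<close>, which is unspecified beyond
  the end of the list; an \<open>n\<close>-ary polynomial never reads there.\<close>

lemma peval_nary_cong:
  assumes "nary n p" "\<And>i. i < n \<Longrightarrow> \<theta> i = \<theta>' i"
  shows "peval p \<theta> = peval p \<theta>'"
  using assms by (intro peval_cong) (auto simp: nary_def)

text \<open>The exponent of \<open>i\<close> in a monomial is 0 or 1, so each monomial contributes a
  constant or a constant times \<open>a\<close>.\<close>

lemma peval_multilinear_affine:
  fixes p :: "nat mpoly" and \<theta> :: "nat \<Rightarrow> nat"
  assumes "\<And>m. m \<in> Poly_Mapping.keys p \<Longrightarrow> Poly_Mapping.lookup m i \<in> {0, 1}"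
  shows "\<exists>A B. \<forall>a. peval p (\<theta>(i := a)) = A + B * a"
proof -
  have "\<exists>A B. \<forall>a. meval m (\<theta>(i := a)) = A + B * a" if m: "m \<in> Poly_Mapping.keys p" for m
  proof -
    let ?S = "Poly_Mapping.keys m"
    define c where "c = (\<Prod>x\<in>?S - {i}. \<theta> x ^ Poly_Mapping.lookup m x)"
    have *: "(\<Prod>x\<in>?S - {i}. (\<theta>(i := a)) x ^ Poly_Mapping.lookup m x) = c" for a
      unfolding c_def by (rule prod.cong) auto
    have "meval m (\<theta>(i := a)) = (if i \<in> ?S then c * a else c)" for a
    proof (cases "i \<in> ?S")
      case True
      then have "Poly_Mapping.lookup m i = 1"
        using assms[OF m] by (auto simp: in_keys_iff)
      then show ?thesis
        unfolding meval_def using True * by (simp add: prod.remove mult.commute)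
    next
      case False
      then show ?thesis unfolding meval_def using *[of a] by simp
    qed
    then show ?thesis
      by (cases "i \<in> ?S") (auto intro: exI[of _ 0] exI[of _ c])
  qed
  then obtain A B where AB: "\<And>m a. m \<in> Poly_Mapping.keys p \<Longrightarrow> meval m (\<theta>(i := a)) = A m + B m * a"
    by metis
  have "peval p (\<theta>(i := a)) =
      (\<Sum>m\<in>Poly_Mapping.keys p. Poly_Mapping.lookup p m * A m) +
      (\<Sum>m\<in>Poly_Mapping.keys p. Poly_Mapping.lookup p m * B m) * a" for a
    unfolding peval_eq_meval by (simp add: AB algebra_simps sum.distrib sum_distrib_left)
  then show ?thesis by blast
qed

section \<open>Annotations and positions\<close>

lemma annot_annot [simp]: "annot \<Phi> (annot \<Psi> t) = annot \<Phi> t"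
  by (induction \<Psi> t arbitrary: \<Phi> rule: annot.induct) auto

lemma poss_annot [simp]: "poss (annot \<Phi> t) = poss t"
  by (induction \<Phi> t rule: annot.induct) auto

lemma Nil_in_poss [simp]: "[] \<in> poss t"
  by (cases t) auto

lemma finite_poss [simp]: "finite (poss t)"
  by (induction t rule: poss.induct) auto

lemma finite_sym_poss [simp]: "finite (sym_poss G t)"
  by (simp add: sym_poss_def)

lemma poss_append: "p @ q \<in> poss t \<longleftrightarrow> p \<in> poss t \<and> q \<in> poss (subt_at t p)"
proof (induction p arbitrary: t)
  case (Cons i p)
  then show ?case by (cases t) auto
qed auto

lemma subt_at_append: "p \<in> poss t \<Longrightarrow> subt_at t (p @ q) = subt_at (subt_at t p) q"
proof (induction p arbitrary: t)
  case (Cons i p)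
  then show ?case by (cases t) auto
qed auto

lemma subt_at_annot:
  "p \<in> poss t \<Longrightarrow> subt_at (annot \<Phi> t) p = annot {q. p @ q \<in> \<Phi>} (subt_at t p)"
proof (induction p arbitrary: t \<Phi>)
  case (Cons i p)
  then show ?case by (cases t) auto
qed auto

lemma defined_poss_iff:
  "p \<in> defined_poss D t \<longleftrightarrow> p \<in> poss t \<and> (\<exists>g ts. subt_at t p = Fun g ts \<and> base g \<in> D)"
proof -
  have "g \<in> Plain ` D \<union> Sharp ` D \<longleftrightarrow> base g \<in> D" for g :: "'a sym"
    by (cases g) auto
  then show ?thesis by (simp add: sym_poss_def)
qed

lemma sharp_poss_iff:
  "p \<in> sharp_poss D t \<longleftrightarrow> p \<in> poss t \<and> (\<exists>f ts. subt_at t p = Fun (Sharp f) ts \<and> f \<in> D)"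
  by (auto simp: sym_poss_def)

lemma sharp_poss_subset: "sharp_poss D t \<subseteq> defined_poss D t"
  by (auto simp: sharp_poss_iff defined_poss_iff)

lemma defined_poss_annot [simp]: "defined_poss D (annot \<Phi> t) = defined_poss D t"
proof (rule set_eqI)
  fix p
  show "p \<in> defined_poss D (annot \<Phi> t) \<longleftrightarrow> p \<in> defined_poss D t"
    by (cases "p \<in> poss t"; cases "subt_at t p") (auto simp: defined_poss_iff subt_at_annot)
qed

text \<open>\<open>annot\<close> marks every function symbol in \<open>\<Phi>\<close> and skips
  variables, while \<open>sharp_poss\<close> counts only marks on defined symbols; hence the
  intersection.\<close>

lemma sharp_poss_annot: "sharp_poss D (annot \<Phi> t) = \<Phi> \<inter> defined_poss D t"
proof (rule set_eqI)
  fix p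
  show "p \<in> sharp_poss D (annot \<Phi> t) \<longleftrightarrow> p \<in> \<Phi> \<inter> defined_poss D t"
    by (cases "p \<in> poss t"; cases "subt_at t p")
       (auto simp: defined_poss_iff sharp_poss_iff subt_at_annot)
qed

lemma flat_eq_defined_poss: "flat s = flat t \<Longrightarrow> defined_poss D s = defined_poss D t"
  by (metis defined_poss_annot[of D "{}"])

lemma flat_eq_annot: "flat s = flat t \<Longrightarrow> annot \<Phi> s = annot \<Phi> t"
  by (metis annot_annot[of \<Phi> "{}"])

lemma flat_eq_poss: "flat s = flat t \<Longrightarrow> poss s = poss t"
  by (metis poss_annot[of "{}"])

lemma flat_subst_flat: "flat (subst \<sigma> (flat r)) = flat (subst \<sigma> r)"
  by (induction r) (auto intro!: nth_equalityI simp: nth_mem)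

lemma flat_eq_subst: "flat r = flat r' \<Longrightarrow> flat (subst \<sigma> r) = flat (subst \<sigma> r')"
  by (metis flat_subst_flat[of \<sigma>])

section \<open>Replacement\<close>

lemma poss_replace_at:
  "\<pi> \<in> poss t \<Longrightarrow> p \<in> poss (replace_at t \<pi> u) \<longleftrightarrow>
    (\<exists>q. p = \<pi> @ q \<and> q \<in> poss u) \<or> (p \<in> poss t \<and> \<not> prefix \<pi> p)"
proof (induction \<pi> arbitrary: t p)
  case (Cons i \<pi>)
  then obtain g ts where t: "t = Fun g ts" "i < length ts" "\<pi> \<in> poss (ts ! i)"
    by (cases t) auto
  show ?case
  proof (cases p)
    case (Cons j p')
    then show ?thesis using Cons.IH[of "ts ! i" p'] t
      by (cases "j = i") (auto simp: image_iff)
  qed (use t in auto)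
qed auto

lemma subt_at_replace_at_below:
  "\<pi> \<in> poss t \<Longrightarrow> subt_at (replace_at t \<pi> u) (\<pi> @ q) = subt_at u q"
proof (induction \<pi> arbitrary: t)
  case (Cons i \<pi>)
  then show ?case by (cases t) auto
qed auto

lemma subt_at_replace_at_parallel:
  "\<pi> \<in> poss t \<Longrightarrow> p \<in> poss t \<Longrightarrow> \<not> prefix p \<pi> \<Longrightarrow> \<not> prefix \<pi> p \<Longrightarrow>
    subt_at (replace_at t \<pi> u) p = subt_at t p"
proof (induction \<pi> arbitrary: t p)
  case (Cons i \<pi>)
  then obtain g ts where t: "t = Fun g ts" "i < length ts" "\<pi> \<in> poss (ts ! i)"
    by (cases t) auto
  show ?case
  proof (cases p)
    case (Cons j p')
    then show ?thesis using Cons.IH[of "ts ! i" p'] Cons.prems t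
      by (cases "j = i") auto
  qed (use Cons.prems in auto)
qed auto

lemma subt_at_replace_at_above:
  "p @ q \<in> poss t \<Longrightarrow> subt_at (replace_at t (p @ q) u) p = replace_at (subt_at t p) q u"
proof (induction p arbitrary: t)
  case (Cons i p)
  then show ?case by (cases t) auto
qed auto

lemma flat_replace_at: "\<pi> \<in> poss t \<Longrightarrow> flat (replace_at t \<pi> u) = replace_at (flat t) \<pi> (flat u)"
proof (induction \<pi> arbitrary: t)
  case (Cons i \<pi>)
  then show ?case
    by (cases t) (auto intro!: nth_equalityI simp: nth_list_update)
qed auto

text \<open>Strictly above the hole only arguments change and the root symbol stays; a position
  parallel to it keeps its whole subterm. So annotations outside the hole survive.\<close>

lemma sharp_poss_replace_at:
  assumes "\<pi> \<in> poss t"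
  shows "sharp_poss D (replace_at t \<pi> u) =
    {p \<in> sharp_poss D t. \<not> prefix \<pi> p} \<union> (@) \<pi> ` sharp_poss D u"
proof (intro set_eqI)
  fix p
  consider q where "p = \<pi> @ q" | i q where "\<pi> = p @ i # q" | "\<not> prefix p \<pi>" "\<not> prefix \<pi> p"
  proof (cases "prefix p \<pi>")
    case True
    then obtain q where "\<pi> = p @ q" by (auto simp: prefix_def)
    then show ?thesis using that(1)[of "[]"] that(2) by (cases q) auto
  next
    case False
    then show ?thesis using that(1,3) by (auto simp: prefix_def)
  qed
  then show "p \<in> sharp_poss D (replace_at t \<pi> u) \<longleftrightarrow>
    p \<in> {p \<in> sharp_poss D t. \<not> prefix \<pi> p} \<union> (@) \<pi> ` sharp_poss D u"
  proof cases
    case 1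
    then show ?thesis
      using assms by (auto simp: sharp_poss_iff poss_replace_at subt_at_replace_at_below)
  next
    case 2
    with assms obtain g ts where "subt_at t p = Fun g ts"
      by (cases "subt_at t p") (auto simp: poss_append)
    with 2 show ?thesis
      using assms
      by (auto simp: sharp_poss_iff poss_replace_at subt_at_replace_at_above poss_append)
  next
    case 3
    then show ?thesis
      using assms
      by (auto simp: sharp_poss_iff poss_replace_at subt_at_replace_at_parallel)
  qed
qed

lemma flat_flat_above [simp]: "flat (flat_above D \<pi> t) = flat t"
  by (simp add: flat_above_def)

lemma sharp_poss_flat_above:
  "sharp_poss D (flat_above D \<pi> t) = {p \<in> sharp_poss D t. \<not> strict_prefix p \<pi>}"
  using sharp_poss_subset[of D t] by (auto simp: flat_above_def sharp_poss_annot)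

section \<open>Substitution\<close>

lemma poss_subst: "p \<in> poss t \<Longrightarrow> p \<in> poss (subst \<sigma> t)"
proof (induction p arbitrary: t)
  case (Cons i p)
  then show ?case by (cases t) auto
qed auto

lemma subt_at_subst: "p \<in> poss t \<Longrightarrow> subt_at (subst \<sigma> t) p = subst \<sigma> (subt_at t p)"
proof (induction p arbitrary: t)
  case (Cons i p)
  then show ?case by (cases t) auto
qed auto

lemma subst_var_poss:
  assumes "p \<in> poss t" "subt_at t p = Var x"
  shows "p @ q \<in> poss (subst \<sigma> t) \<longleftrightarrow> q \<in> poss (\<sigma> x)"
    and "subt_at (subst \<sigma> t) (p @ q) = subt_at (\<sigma> x) q"
  using assms by (auto simp: poss_append subt_at_append subt_at_subst poss_subst)

lemma defined_poss_subst: "defined_poss D t \<subseteq> defined_poss D (subst \<sigma> t)"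
  by (auto simp: defined_poss_iff poss_subst subt_at_subst)

text \<open>A proper extension of a variable position is not a position, so no variable position is
  a prefix of another. This makes the splitting of a position into \<open>\<rho>\<close> and
  \<open>\<tau>\<close> unique.\<close>

lemma var_poss_parallel:
  assumes "\<rho> \<in> var_poss l" "\<rho>' \<in> var_poss l" "\<rho> @ \<tau> = \<rho>' @ \<tau>'"
  shows "\<rho> = \<rho>'" "\<tau> = \<tau>'"
proof -
  have *: "us = []" if "\<rho>1 \<in> var_poss l" "\<rho>1 @ us \<in> var_poss l" for \<rho>1 us
    using that by (auto simp: var_poss_def poss_append)
  from assms(3) obtain us where "\<rho> = \<rho>' @ us \<or> \<rho>' = \<rho> @ us"
    by (metis append_eq_append_conv2)
  then show "\<rho> = \<rho>'"
    using assms(1,2) * by fastforce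
  then show "\<tau> = \<tau>'" using assms(3) by simp
qed

section \<open>Well-formed terms\<close>

lemma terms_over_mono: "t \<in> terms_over ar G \<Longrightarrow> G \<subseteq> H \<Longrightarrow> t \<in> terms_over ar H"
  by (induction rule: terms_over.induct) (auto intro: terms_over.intros)

lemma plain_subset_sharp: "t \<in> plain_terms ar \<Longrightarrow> t \<in> sharp_terms ar D"
  unfolding plain_terms_def sharp_terms_def by (erule terms_over_mono) (auto simp: sharp_sig_def)

lemma Fun_in_terms_over:
  "Fun g ts \<in> terms_over ar G \<longleftrightarrow> g \<in> G \<and> length ts = ar (base g) \<and> (\<forall>t\<in>set ts. t \<in> terms_over ar G)"
  by (auto intro: terms_over.intros elim: terms_over.cases)

lemma subt_at_in_terms_over:
  "t \<in> terms_over ar G \<Longrightarrow> p \<in> poss t \<Longrightarrow> subt_at t p \<in> terms_over ar G"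
proof (induction p arbitrary: t)
  case (Cons i p)
  then show ?case by (cases t) (auto simp: Fun_in_terms_over)
qed auto

lemma replace_at_in_terms_over:
  "t \<in> terms_over ar G \<Longrightarrow> p \<in> poss t \<Longrightarrow> u \<in> terms_over ar G \<Longrightarrow> replace_at t p u \<in> terms_over ar G"
proof (induction p arbitrary: t)
  case (Cons i p)
  then obtain g ts where t: "t = Fun g ts" "i < length ts" "p \<in> poss (ts ! i)"
    by (cases t) auto
  have "set (ts[i := replace_at (ts ! i) p u]) \<subseteq> insert (replace_at (ts ! i) p u) (set ts)"
    by (rule set_update_subset_insert)
  then show ?case using Cons t by (auto simp: Fun_in_terms_over)
qed auto

lemma subst_in_terms_over:
  "t \<in> terms_over ar G \<Longrightarrow> (\<And>x. \<sigma> x \<in> terms_over ar G) \<Longrightarrow> subst \<sigma> t \<in> terms_over ar G"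
  by (induction rule: terms_over.induct) (auto simp: Fun_in_terms_over)

lemma annot_in_sharp_terms:
  assumes "t \<in> terms_over ar G"
    and "\<And>p g ts. p \<in> \<Phi> \<Longrightarrow> p \<in> poss t \<Longrightarrow> subt_at t p = Fun g ts \<Longrightarrow> base g \<in> D"
  shows "annot \<Phi> t \<in> sharp_terms ar D"
  using assms
proof (induction arbitrary: \<Phi> rule: terms_over.induct)
  case (Var x)
  then show ?case by (auto simp: sharp_terms_def intro: terms_over.intros)
next
  case (Fun g ts)
  have "annot {p. i # p \<in> \<Phi>} (ts ! i) \<in> sharp_terms ar D" if "i < length ts" for i
  proof -
    have "base g' \<in> D" if "p \<in> {p. i # p \<in> \<Phi>}" "p \<in> poss (ts ! i)" "subt_at (ts ! i) p = Fun g' us" for p g' us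
      using Fun.prems[of "i # p" g' us] that \<open>i < length ts\<close> by auto
    moreover have "ts ! i \<in> set ts" using that by simp
    ultimately show ?thesis using Fun.IH by blast
  qed
  then show ?case
    using Fun.hyps Fun.prems[of "[]"]
    by (auto simp: sharp_terms_def Fun_in_terms_over sharp_sig_def)
qed

lemma flat_above_in_sharp_terms:
  "t \<in> sharp_terms ar D \<Longrightarrow> flat_above D \<pi> t \<in> sharp_terms ar D"
  unfolding flat_above_def sharp_terms_def[of ar]
  by (rule annot_in_sharp_terms[unfolded sharp_terms_def]) (auto simp: sharp_poss_iff)

lemma flat_in_plain_terms: "t \<in> terms_over ar G \<Longrightarrow> flat t \<in> plain_terms ar"
  unfolding plain_terms_def
  by (induction rule: terms_over.induct)
     (auto simp: all_set_conv_all_nth intro!: terms_over.intros)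

lemma flat_plain: "t \<in> plain_terms ar \<Longrightarrow> flat t = t"
  unfolding plain_terms_def
  by (induction rule: terms_over.induct)
     (auto simp: all_set_conv_all_nth intro!: nth_equalityI)

lemma is_subst_plain: "is_subst ar \<sigma> \<Longrightarrow> \<sigma> x \<in> plain_terms ar"
  by (simp add: is_subst_def)

lemma subst_in_sharp_terms: "t \<in> sharp_terms ar D \<Longrightarrow> is_subst ar \<sigma> \<Longrightarrow> subst \<sigma> t \<in> sharp_terms ar D"
  unfolding sharp_terms_def
  using plain_subset_sharp[OF is_subst_plain, unfolded sharp_terms_def]
  by (intro subst_in_terms_over) auto

lemma flat_subst:
  "is_subst ar \<sigma> \<Longrightarrow> flat (subst \<sigma> r) = subst \<sigma> (flat r)"
  by (induction r) (auto intro!: nth_equalityI simp: flat_plain[OF is_subst_plain])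

section \<open>Rewrite steps\<close>

text \<open>The same variable stands at \<open>\<rho>\<close> in \<open>l\<close> and at
  \<open>\<pi>\<close> in \<open>r\<close>, so the same instance lies below both: a copied
  annotation sits on a copy of its old subterm.\<close>

lemma Psi_copy:
  assumes flat: "flat u = subst \<sigma> l" and vrf: "is_vrf l r \<phi>"
    and \<rho>: "\<rho> \<in> var_poss l" "\<phi> \<rho> = Some \<pi>" "\<rho> @ \<tau> \<in> sharp_poss D u"
  shows "\<pi> @ \<tau> \<in> defined_poss D (subst \<sigma> r)"
    and "subt_at (subst \<sigma> r) (\<pi> @ \<tau>) = subt_at (flat u) (\<rho> @ \<tau>)"
proof -
  obtain x where x: "subt_at l \<rho> = Var x" "subt_at r \<pi> = Var x" "\<rho> \<in> poss l" "\<pi> \<in> poss r"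
    using vrf \<rho> by (auto simp: is_vrf_def var_poss_def)
  have "\<rho> @ \<tau> \<in> defined_poss D (flat u)"
    using \<rho>(3) sharp_poss_subset[of D u] by auto
  then show "\<pi> @ \<tau> \<in> defined_poss D (subst \<sigma> r)"
    unfolding flat using subst_var_poss[OF x(3,1)] subst_var_poss[OF x(4,2)]
    by (simp add: defined_poss_iff)
  show "subt_at (subst \<sigma> r) (\<pi> @ \<tau>) = subt_at (flat u) (\<rho> @ \<tau>)"
    unfolding flat using subst_var_poss[OF x(3,1)] subst_var_poss[OF x(4,2)] by simp
qed

lemma Psi_defined:
  assumes "flat u = subst \<sigma> l" "is_vrf l r \<phi>"
  shows "Psi D l u \<phi> \<subseteq> defined_poss D (subst \<sigma> r)"
  using Psi_copy(1)[OF assms] by (auto simp: Psi_def)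

lemma Phi_defined:
  assumes "flat u = subst \<sigma> l" "is_vrf l r \<phi>"
  shows "Phi D l r u \<phi> \<subseteq> defined_poss D (subst \<sigma> r)"
  using Psi_defined[OF assms] sharp_poss_subset[of D r] defined_poss_subst[of D r \<sigma>]
  by (auto simp: Phi_def)

text \<open>Lets the three cases of \<open>result\<close> be treated as one: they differ only in
  this set and in the use of \<open>flat_above\<close>.\<close>

definition new_poss :: "step_case \<Rightarrow> 'f set \<Rightarrow> ('f, 'v) atrm \<Rightarrow> ('f, 'v) atrm \<Rightarrow> ('f, 'v) atrm \<Rightarrow>
    (pos \<Rightarrow> pos option) \<Rightarrow> pos set" where
  "new_poss c D l r u \<phi> = (if c = NT then Psi D l u \<phi> else Phi D l r u \<phi>)"

lemma new_poss_defined: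
  assumes "flat u = subst \<sigma> l" "is_vrf l r \<phi>"
  shows "new_poss c D l r u \<phi> \<subseteq> defined_poss D (subst \<sigma> r)"
  using Psi_defined[OF assms] Phi_defined[OF assms] by (simp add: new_poss_def)

lemma result_eq:
  "result c D s \<pi> l \<sigma> r \<phi> = (if c = AF then flat_above D \<pi> else id)
    (replace_at s \<pi> (annot (new_poss c D l r (subt_at s \<pi>) \<phi>) (subst \<sigma> r)))"
  by (cases c) (auto simp: new_poss_def)

lemma flat_result:
  "\<pi> \<in> poss s \<Longrightarrow> flat (result c D s \<pi> l \<sigma> r \<phi>) = replace_at (flat s) \<pi> (flat (subst \<sigma> r))"
  by (simp add: result_eq flat_replace_at)

lemma not_strict_prefix_append [simp]: "\<not> strict_prefix (xs @ ys) xs"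
  by (meson prefixI prefix_order.leD)

lemma sharp_poss_result:
  assumes "\<pi> \<in> poss s" "flat (subt_at s \<pi>) = subst \<sigma> l" "is_vrf l r \<phi>"
  shows "sharp_poss D (result c D s \<pi> l \<sigma> r \<phi>) =
    {p \<in> sharp_poss D s. \<not> prefix \<pi> p \<and> (c = AF \<longrightarrow> \<not> strict_prefix p \<pi>)} \<union>
    (@) \<pi> ` new_poss c D l r (subt_at s \<pi>) \<phi>"
proof -
  \<comment> \<open>All new positions carry defined symbols, so the intersection in
    \<open>sharp_poss_annot\<close> loses none of them.\<close>
  have "new_poss c D l r (subt_at s \<pi>) \<phi> \<inter> defined_poss D (subst \<sigma> r) = new_poss c D l r (subt_at s \<pi>) \<phi>"
    using new_poss_defined[OF assms(2,3)] by blast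
  then show ?thesis
    using assms(1)
    by (auto simp: result_eq sharp_poss_replace_at sharp_poss_annot sharp_poss_flat_above)
qed

lemma result_in_sharp_terms:
  assumes "\<pi> \<in> poss s" "flat (subt_at s \<pi>) = subst \<sigma> l" "is_vrf l r \<phi>"
    and "s \<in> sharp_terms ar D" "r \<in> sharp_terms ar D" "is_subst ar \<sigma>"
  shows "result c D s \<pi> l \<sigma> r \<phi> \<in> sharp_terms ar D"
proof -
  let ?N = "new_poss c D l r (subt_at s \<pi>) \<phi>"
  have "annot ?N (subst \<sigma> r) \<in> sharp_terms ar D"
    by (rule annot_in_sharp_terms[OF subst_in_sharp_terms[OF assms(5,6), unfolded sharp_terms_def]])
       (use new_poss_defined[OF assms(2,3), of c D] in \<open>fastforce simp: defined_poss_iff\<close>)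
  then have *: "replace_at s \<pi> (annot ?N (subst \<sigma> r)) \<in> sharp_terms ar D"
    using assms(1,4) replace_at_in_terms_over unfolding sharp_terms_def by blast
  show ?thesis
    unfolding result_eq using * flat_above_in_sharp_terms[OF *] by (auto simp only: if_True if_False id_apply split: if_split)
qed

section \<open>The weight of a term along rewrite steps\<close>

lemma subt_at_flat: "p \<in> poss t \<Longrightarrow> subt_at (flat t) p = flat (subt_at t p)"
  by (simp add: subt_at_annot)

lemma replace_at_subt_at: "p \<in> poss t \<Longrightarrow> replace_at t p (subt_at t p) = t"
proof (induction p arbitrary: t)
  case (Cons i p)
  then show ?case by (cases t) auto
qed auto

section \<open>Sums over matched multisets\<close>

lemma rel_msetE:
  assumes "rel_mset R A B"
  obtains Z where "A = image_mset fst Z" "B = image_mset snd Z" "\<And>z. z \<in># Z \<Longrightarrow> R (fst z) (snd z)"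
proof -
  from assms obtain Z where "set_mset Z \<subseteq> {(x, y). R x y}" "image_mset fst Z = A" "image_mset snd Z = B"
    unfolding multiset.in_rel by blast
  then show ?thesis by (intro that[of Z]) auto
qed

lemma rel_mset_sum_le:
  fixes f :: "'a \<Rightarrow> real"
  assumes "rel_mset R A B" "\<And>a b. a \<in># A \<Longrightarrow> R a b \<Longrightarrow> g b \<le> f a"
  shows "(\<Sum>b\<in>#B. g b) \<le> (\<Sum>a\<in>#A. f a)"
proof -
  obtain Z where Z: "A = image_mset fst Z" "B = image_mset snd Z" "\<And>z. z \<in># Z \<Longrightarrow> R (fst z) (snd z)"
    using rel_msetE[OF assms(1)] by metis
  show ?thesis
    unfolding Z(1,2) image_mset.compositionality
    by (rule sum_mset_mono) (use assms(2) Z in auto)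
qed

lemma rel_mset_obtain:
  assumes "rel_mset R A B" "a \<in># A"
  obtains b where "b \<in># B" "R a b"
proof -
  obtain Z where Z: "A = image_mset fst Z" "B = image_mset snd Z" "\<And>z. z \<in># Z \<Longrightarrow> R (fst z) (snd z)"
    using rel_msetE[OF assms(1)] by metis
  then obtain z where "z \<in># Z" "a = fst z" using assms(2) by auto
  then show ?thesis using that[of "snd z"] Z by auto
qed

locale multilinear_interp =
  fixes ar :: "'f \<Rightarrow> nat" and D :: "'f set" and Pol :: "'f sym \<Rightarrow> nat mpoly"
  assumes interp: "poly_interp ar D Pol" "multilinear D Pol"
begin

text \<open>The conditions on the interpretation hold under every instantiation, so a fixed one may
  be used. As values are natural numbers, every strict decrease is at least 1.\<close>

definition val :: "('f, 'v) atrm \<Rightarrow> nat" where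
  "val t = peval (pol Pol t) (\<lambda>_. 0)"

text \<open>Annotations inside a subterm are erased before its root is annotated, as in
  \<open>Sum_pol\<close>. A summand thus depends only on \<open>flat s\<close> and the
  position.\<close>

definition weight :: "('f, 'v) atrm \<Rightarrow> nat" where
  "weight s = (\<Sum>p\<in>sharp_poss D s. val (sharp (subt_at (flat s) p)))"

lemma peval_pol_Fun:
  fixes \<rho> :: "'v \<Rightarrow> nat"
  assumes "g \<in> sharp_sig D" "length ts = ar (base g)"
  shows "peval (pol Pol (Fun g ts)) \<rho> = peval (Pol g) (\<lambda>i. peval (pol Pol (ts ! i)) \<rho>)"
proof -
  have "nary (ar (base g)) (Pol g)"
    using interp(1) assms(1) by (simp add: poly_interp_def)
  then show ?thesis
    by (simp add: peval_peval) (rule peval_nary_cong, use assms(2) in auto)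
qed

lemma peval_pol_subst:
  fixes \<rho> :: "'v \<Rightarrow> nat"
  assumes "t \<in> sharp_terms ar D"
  shows "peval (pol Pol (subst \<sigma> t)) \<rho> = peval (pol Pol t) (\<lambda>x. peval (pol Pol (\<sigma> x)) \<rho>)"
  using assms unfolding sharp_terms_def
proof (induction rule: terms_over.induct)
  case (Fun g ts)
  have "nary (length ts) (Pol g)"
    using interp(1) Fun by (simp add: poly_interp_def)
  moreover have "peval (pol Pol (map (subst \<sigma>) ts ! i)) \<rho> =
      peval (pol Pol (ts ! i)) (\<lambda>x. peval (pol Pol (\<sigma> x)) \<rho>)" if "i < length ts" for i
    using Fun.IH that by simp
  ultimately have "peval (Pol g) (\<lambda>i. peval (pol Pol (map (subst \<sigma>) ts ! i)) \<rho>) =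
      peval (Pol g) (\<lambda>i. peval (pol Pol (ts ! i)) (\<lambda>x. peval (pol Pol (\<sigma> x)) \<rho>))"
    by (rule peval_nary_cong)
  moreover have "peval (pol Pol (subst \<sigma> (Fun g ts))) \<rho> =
      peval (Pol g) (\<lambda>i. peval (pol Pol (map (subst \<sigma>) ts ! i)) \<rho>)"
    unfolding subst.simps by (rule peval_pol_Fun) (use Fun in auto)
  moreover have "peval (pol Pol (Fun g ts)) (\<lambda>x. peval (pol Pol (\<sigma> x)) \<rho>) =
      peval (Pol g) (\<lambda>i. peval (pol Pol (ts ! i)) (\<lambda>x. peval (pol Pol (\<sigma> x)) \<rho>))"
    by (rule peval_pol_Fun) (use Fun in auto)
  ultimately show ?case by simp
qed simp

lemma val_subst:
  "t \<in> sharp_terms ar D \<Longrightarrow> val (subst \<sigma> t) = peval (pol Pol t) (\<lambda>x. val (\<sigma> x))"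
  unfolding val_def by (rule peval_pol_subst)

text \<open>Multilinearity makes every one-hole context an affine map, so it commutes with expectations.\<close>

lemma val_replace_at_affine:
  "t \<in> sharp_terms ar D \<Longrightarrow> p \<in> poss t \<Longrightarrow> \<exists>A B. \<forall>y. val (replace_at t p y) = A + B * val y"
proof (induction p arbitrary: t)
  case Nil
  show ?case by (rule exI[of _ 0], rule exI[of _ 1]) simp
next
  case (Cons i p)
  then obtain g ts where t: "t = Fun g ts" "i < length ts" "p \<in> poss (ts ! i)"
    by (cases t) auto
  have wf: "g \<in> sharp_sig D" "length ts = ar (base g)" "ts ! i \<in> sharp_terms ar D"
    using Cons.prems t by (auto simp: sharp_terms_def Fun_in_terms_over)
  obtain A B where AB: "\<And>y. val (replace_at (ts ! i) p y) = A + B * val y"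
    using Cons.IH[OF wf(3) t(3)] by blast
  define \<theta> where "\<theta> = (\<lambda>j. val (ts ! j))"
  obtain A' B' where AB': "\<And>a. peval (Pol g) (\<theta>(i := a)) = A' + B' * a"
    using peval_multilinear_affine[of "Pol g" i \<theta>] interp(2) wf(1) by (auto simp: multilinear_def)
  \<comment> \<open>The root polynomial is affine in argument \<open>i\<close>, which by induction
    is affine in the hole; the two maps are composed.\<close>
  have "val (replace_at t (i # p) y) = (A' + B' * A) + (B' * B) * val y" for y
  proof -
    let ?y = "replace_at (ts ! i) p y"
    have "nary (length ts) (Pol g)"
      using interp(1) wf(1,2) by (simp add: poly_interp_def)
    then have "peval (Pol g) (\<lambda>j. val (ts[i := ?y] ! j)) = peval (Pol g) (\<theta>(i := val ?y))"
      by (rule peval_nary_cong) (auto simp: \<theta>_def nth_list_update)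
    moreover have "val (replace_at t (i # p) y) = peval (Pol g) (\<lambda>j. val (ts[i := ?y] ! j))"
      unfolding t(1) replace_at.simps val_def by (rule peval_pol_Fun) (use wf in auto)
    ultimately show ?thesis
      by (simp add: AB AB' algebra_simps)
  qed
  then show ?case by blast
qed

text \<open>As \<open>q\<close> is nonempty, the root lies outside the hole, so annotating it
  commutes with the replacement and \<open>val_replace_at_affine\<close> applies.\<close>

lemma val_sharp_replace_at_affine:
  assumes t: "Fun (Plain f) ts \<in> plain_terms ar" "f \<in> D" and q: "q \<in> poss (Fun (Plain f) ts)" "q \<noteq> []"
  shows "\<exists>A B. \<forall>y. val (sharp (replace_at (Fun (Plain f) ts) q y)) = A + B * val y"
proof -
  obtain i q' where q': "q = i # q'" using q(2) by (cases q) auto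
  have "Fun (Sharp f) ts \<in> sharp_terms ar D"
    using plain_subset_sharp[OF t(1), of D] t(2) by (auto simp: sharp_terms_def Fun_in_terms_over sharp_sig_def)
  moreover have "q \<in> poss (Fun (Sharp f) ts)" using q(1) by simp
  moreover have "sharp (replace_at (Fun (Plain f) ts) q y) = replace_at (Fun (Sharp f) ts) q y" for y
    by (simp add: q')
  ultimately show ?thesis
    using val_replace_at_affine[of "Fun (Sharp f) ts" q] by simp
qed

text \<open>Each annotation in the reduct is traced back to the one it was copied from. A VRF is a
  function, so it moves annotations without duplicating them and the tracing is injective; by
  \<open>Psi_copy\<close> the values agree.\<close>

lemma sum_Psi_le:
  assumes flat: "flat u = subst \<sigma> l" and vrf: "is_vrf l r \<phi>" and l: "\<nexists>x. l = Var x"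
  shows "(\<Sum>q\<in>Psi D l u \<phi>. val (sharp (subt_at (flat (subst \<sigma> r)) q))) \<le>
    (\<Sum>q\<in>sharp_poss D u - {[]}. val (sharp (subt_at (flat u) q)))"
proof -
  define copy where "copy q q' \<longleftrightarrow> (\<exists>\<pi> \<tau> \<rho>. q = \<pi> @ \<tau> \<and> q' = \<rho> @ \<tau> \<and> \<rho> \<in> var_poss l \<and>
    \<phi> \<rho> = Some \<pi> \<and> \<rho> @ \<tau> \<in> sharp_poss D u)" for q q'
  have "\<forall>q\<in>Psi D l u \<phi>. \<exists>q'. copy q q'"
    unfolding Psi_def copy_def by blast
  then obtain j where "\<forall>q\<in>Psi D l u \<phi>. copy q (j q)"
    by (rule bchoice[elim_format]) blast
  then have j: "copy q (j q)" if "q \<in> Psi D l u \<phi>" for q using that by blast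
  have "inj_on j (Psi D l u \<phi>)"
  proof (rule inj_onI)
    fix q q' assume *: "q \<in> Psi D l u \<phi>" "q' \<in> Psi D l u \<phi>" "j q = j q'"
    from j[OF *(1)] obtain \<pi> \<tau> \<rho> where
      1: "q = \<pi> @ \<tau>" "j q = \<rho> @ \<tau>" "\<rho> \<in> var_poss l" "\<phi> \<rho> = Some \<pi>"
      unfolding copy_def by blast
    from j[OF *(2)] obtain \<pi>' \<tau>' \<rho>' where
      2: "q' = \<pi>' @ \<tau>'" "j q' = \<rho>' @ \<tau>'" "\<rho>' \<in> var_poss l" "\<phi> \<rho>' = Some \<pi>'"
      unfolding copy_def by blast
    \<comment> \<open>The origin determines \<open>\<rho>\<close> and \<open>\<tau>\<close>, and
      then \<open>\<phi>\<close> determines \<open>\<pi>\<close>.\<close>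
    have "\<rho> @ \<tau> = \<rho>' @ \<tau>'" using 1(2) 2(2) *(3) by simp
    note var_poss_parallel[OF 1(3) 2(3) this]
    then show "q = q'" using 1 2 by simp
  qed
  moreover have "subt_at (flat (subst \<sigma> r)) q = subt_at (flat u) (j q)" if q: "q \<in> Psi D l u \<phi>" for q
  proof -
    obtain \<pi> \<tau> \<rho> where
      *: "q = \<pi> @ \<tau>" "j q = \<rho> @ \<tau>" "\<rho> \<in> var_poss l" "\<phi> \<rho> = Some \<pi>" "\<rho> @ \<tau> \<in> sharp_poss D u"
      using j[OF q] unfolding copy_def by blast
    have "q \<in> poss (subst \<sigma> r)" "subt_at (subst \<sigma> r) q = subt_at (flat u) (j q)" "j q \<in> poss u"
      using Psi_copy[OF flat vrf *(3-5)] *(1,2,5) by (simp_all add: defined_poss_iff sharp_poss_iff)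
    then show ?thesis by (simp add: subt_at_flat)
  qed
  ultimately have "(\<Sum>q\<in>Psi D l u \<phi>. val (sharp (subt_at (flat (subst \<sigma> r)) q))) =
      (\<Sum>q\<in>j ` Psi D l u \<phi>. val (sharp (subt_at (flat u) q)))"
    by (simp add: sum.reindex)
  also have "\<dots> \<le> (\<Sum>q\<in>sharp_poss D u - {[]}. val (sharp (subt_at (flat u) q)))"
  proof (rule sum_mono2)
    \<comment> \<open>Origins lie at or below variable positions of \<open>l\<close>, hence strictly
      below the root of the redex.\<close>
    have "[] \<notin> var_poss l" using l by (auto simp: var_poss_def)
    then show "j ` Psi D l u \<phi> \<subseteq> sharp_poss D u - {[]}"
      using j unfolding copy_def by fastforce
  qed auto
  finally show ?thesis .
qed

lemma sum_sharp_poss_subst: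
  fixes r :: "('f, 'v) atrm"
  assumes r: "r \<in> sharp_terms ar D" and \<sigma>: "is_subst ar \<sigma>"
  shows "(\<Sum>q\<in>sharp_poss D r. val (sharp (subt_at (flat (subst \<sigma> r)) q))) =
    peval (Sum_pol D Pol r) (\<lambda>x. val (\<sigma> x))"
proof -
  have "val (sharp (subt_at (flat (subst \<sigma> r)) q)) =
      peval (pol Pol (sharp (flat (subt_at r q)))) (\<lambda>x. val (\<sigma> x))" if q: "q \<in> sharp_poss D r" for q
  proof -
    obtain f ts where *: "subt_at r q = Fun (Sharp f) ts" "f \<in> D" "q \<in> poss r"
      using q by (auto simp: sharp_poss_iff)
    have "flat (subt_at r q) \<in> plain_terms ar"
      using r *(3) unfolding sharp_terms_def by (intro flat_in_plain_terms subt_at_in_terms_over)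
    then have "sharp (flat (subt_at r q)) \<in> sharp_terms ar D"
      using *(1,2) plain_subset_sharp[of "flat (subt_at r q)" ar D]
      by (auto simp: sharp_terms_def Fun_in_terms_over sharp_sig_def)
    moreover have "subt_at (flat (subst \<sigma> r)) q = subst \<sigma> (flat (subt_at r q))"
      using *(3) \<sigma> by (simp add: flat_subst subt_at_subst subt_at_flat)
    moreover have "sharp (subst \<sigma> (flat (subt_at r q))) = subst \<sigma> (sharp (flat (subt_at r q)))"
      using *(1) by simp
    ultimately show ?thesis by (simp add: val_subst del: sharp.simps)
  qed
  then show ?thesis by (simp add: Sum_pol_def peval_sum)
qed

text \<open>The point is that \<open>C\<close> and \<open>B\<close> are the same for the redex and
  for all branches, so bounds may be averaged. \<open>C\<close> collects the constants of the
  contexts above \<open>\<pi>\<close>, the annotated subterms parallel to \<open>\<pi>\<close>, and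
  those strictly inside the redex; \<open>B\<close> is the total slope of the contexts above. Case
  \<open>AF\<close> erases the annotations above, hence \<open>B = 0\<close>.\<close>

lemma weight_result:
  fixes s :: "('f, 'v) atrm"
  assumes s: "s \<in> sharp_terms ar D" and \<pi>: "\<pi> \<in> defined_poss D s"
    and match: "flat (subt_at s \<pi>) = subst \<sigma> l"
    and l: "l \<in> plain_terms ar" "\<nexists>x. l = Var x" and \<sigma>: "is_subst ar \<sigma>"
    and c: "c = NT \<or> \<pi> \<in> sharp_poss D s"
  defines "\<rho> \<equiv> (\<lambda>x. val (\<sigma> x))"
  shows "\<exists>C B. (c = AF \<longrightarrow> B = 0) \<and>
    C + B * peval (pol Pol l) \<rho> + (if c = NT then 0 else peval (pol Pol (sharp l)) \<rho>) \<le> weight s \<and>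
    (\<forall>r \<phi>. is_vrf l r \<phi> \<longrightarrow> r \<in> sharp_terms ar D \<longrightarrow>
      weight (result c D s \<pi> l \<sigma> r \<phi>) \<le>
        C + B * peval (pol Pol (flat r)) \<rho> + (if c = NT then 0 else peval (Sum_pol D Pol r) \<rho>))"
proof -
  define F where "F = flat s"
  define u where "u = subt_at s \<pi>"
  define w where "w G p = val (sharp (subt_at G p))" for G :: "('f, 'v) atrm" and p
  define above where "above = {p \<in> sharp_poss D s. strict_prefix p \<pi>}"
  define par where "par = {p \<in> sharp_poss D s. \<not> prefix p \<pi> \<and> \<not> prefix \<pi> p}"
  \<comment> \<open>A bound for everything that \<open>Psi\<close> can carry over, whatever the
    branch and its VRF.\<close>
  define Z where "Z = (\<Sum>q\<in>sharp_poss D u - {[]}. w (flat u) q)"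
  have \<pi>s: "\<pi> \<in> poss s" using \<pi> by (simp add: defined_poss_iff)
  have F: "F \<in> plain_terms ar" "\<pi> \<in> poss F" "subt_at F \<pi> = subst \<sigma> l"
    using s \<pi>s match flat_in_plain_terms by (auto simp: F_def sharp_terms_def subt_at_flat)
  have fin: "finite above" "finite par" by (auto simp: above_def par_def)
  have sharp_decomp: "sharp_poss D s = above \<union> par \<union> (@) \<pi> ` sharp_poss D u"
  proof -
    have "{p \<in> sharp_poss D s. prefix \<pi> p} = (@) \<pi> ` sharp_poss D u"
      using \<pi>s by (auto simp: sharp_poss_iff prefix_def poss_append subt_at_append u_def)
    then show ?thesis by (auto simp: above_def par_def strict_prefix_def)
  qed
  have split_sum: "(\<Sum>p\<in>X \<union> par \<union> (@) \<pi> ` N. h p) =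
      (\<Sum>p\<in>X. h p) + (\<Sum>p\<in>par. h p) + (\<Sum>q\<in>N. h (\<pi> @ q))"
    if "X \<subseteq> above" "finite N" for X N and h :: "pos \<Rightarrow> nat"
  proof -
    have "finite X" using that(1) fin(1) finite_subset by blast
    moreover have "X \<inter> par = {}" "(X \<union> par) \<inter> (@) \<pi> ` N = {}"
      using that(1) by (auto simp: above_def par_def strict_prefix_def)
    ultimately show ?thesis
      using that(2) fin by (simp add: sum.union_disjoint sum.reindex inj_on_def)
  qed

  have "\<exists>A B. \<forall>y. w (replace_at F \<pi> y) p = A + B * val y" if p: "p \<in> above" for p
  proof -
    obtain q where q: "\<pi> = p @ q" "q \<noteq> []"
      using p by (auto simp: above_def strict_prefix_def prefix_def)
    obtain f ts where f: "subt_at s p = Fun (Sharp f) ts" "f \<in> D" "p \<in> poss s"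
      using p by (auto simp: above_def sharp_poss_iff)
    obtain us where "subt_at F p = Fun (Plain f) us"
      using f by (simp add: F_def subt_at_flat)
    moreover have "subt_at F p \<in> plain_terms ar"
      using F(1) f(3) unfolding plain_terms_def by (intro subt_at_in_terms_over) (simp_all add: F_def)
    moreover have "q \<in> poss (subt_at F p)"
      using F(2) unfolding q(1) poss_append by simp
    ultimately have "\<exists>A B. \<forall>y. val (sharp (replace_at (subt_at F p) q y)) = A + B * val y"
      using val_sharp_replace_at_affine[of f us q] f(2) q(2) by simp
    moreover have "subt_at (replace_at F \<pi> y) p = replace_at (subt_at F p) q y" for y
      using F(2) unfolding q(1) by (rule subt_at_replace_at_above)
    ultimately show ?thesis by (simp add: w_def)
  qed
  then have "\<forall>p\<in>above. \<exists>A B. \<forall>y. w (replace_at F \<pi> y) p = A + B * val y" by blast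
  then obtain A where "\<forall>p\<in>above. \<exists>B. \<forall>y. w (replace_at F \<pi> y) p = A p + B * val y"
    by (rule bchoice[elim_format]) blast
  then obtain B where AB: "\<And>p y. p \<in> above \<Longrightarrow> w (replace_at F \<pi> y) p = A p + B p * val y"
    by (rule bchoice[elim_format]) blast
  have w_par: "w (replace_at F \<pi> y) p = w F p" if "p \<in> par" for p y
    using that F(2) unfolding w_def
    by (subst subt_at_replace_at_parallel) (auto simp: par_def F_def sharp_poss_iff)
  \<comment> \<open>The annotations above \<open>\<pi>\<close> that survive. In the lower bound,
    leaving out the others only drops nonnegative summands.\<close>
  define keep where "keep = (if c = AF then {} else above)"
  define C where "C = (\<Sum>p\<in>keep. A p) + (\<Sum>p\<in>par. w F p) + Z"
  define B' where "B' = (\<Sum>p\<in>keep. B p)"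
  have keep: "keep \<subseteq> above" by (auto simp: keep_def)

  have lhs_eq: "val (subst \<sigma> l) = peval (pol Pol l) \<rho>"
    using val_subst[OF plain_subset_sharp[OF l(1)]] by (simp add: \<rho>_def)
  have lower: "C + B' * peval (pol Pol l) \<rho> +
      (if c = NT then 0 else peval (pol Pol (sharp l)) \<rho>) \<le> weight s"
  proof -
    \<comment> \<open>With the redex itself put into the hole, the affine formulas describe
      \<open>s\<close>.\<close>
    have FF: "replace_at F \<pi> (subst \<sigma> l) = F"
      using replace_at_subt_at[OF F(2)] F(3) by simp
    have "weight s = (\<Sum>p\<in>sharp_poss D s. w F p)"
      by (simp add: weight_def w_def F_def)
    also have "\<dots> = (\<Sum>p\<in>above. w F p) + (\<Sum>p\<in>par. w F p) + (\<Sum>q\<in>sharp_poss D u. w F (\<pi> @ q))"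
      unfolding sharp_decomp by (rule split_sum) auto
    also have "(\<Sum>p\<in>above. w F p) = (\<Sum>p\<in>above. A p + B p * peval (pol Pol l) \<rho>)"
      using AB[of _ "subst \<sigma> l"] by (simp add: FF lhs_eq)
    also have "(\<Sum>q\<in>sharp_poss D u. w F (\<pi> @ q)) = (\<Sum>q\<in>sharp_poss D u. w (flat u) q)"
      using F(2,3) match by (simp add: w_def subt_at_append u_def)
    finally have ws: "weight s = (\<Sum>p\<in>above. A p + B p * peval (pol Pol l) \<rho>) +
        (\<Sum>p\<in>par. w F p) + (\<Sum>q\<in>sharp_poss D u. w (flat u) q)" .
    have "(\<Sum>p\<in>keep. A p + B p * peval (pol Pol l) \<rho>) \<le> (\<Sum>p\<in>above. A p + B p * peval (pol Pol l) \<rho>)"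
      by (rule sum_mono2) (use fin keep in auto)
    moreover have "(if c = NT then 0 else peval (pol Pol (sharp l)) \<rho>) + Z \<le>
        (\<Sum>q\<in>sharp_poss D u. w (flat u) q)"
    proof (cases "c = NT")
      case True
      then show ?thesis unfolding Z_def by (simp add: sum_mono2)
    next
      case False
      then have "[] \<in> sharp_poss D u"
        using c by (auto simp: sharp_poss_iff u_def)
      then obtain f ts where f: "u = Fun (Sharp f) ts" "f \<in> D" by (auto simp: sharp_poss_iff)
      obtain ls where ls: "l = Fun (Plain f) ls"
        using l(2) f match by (cases l) (auto simp: u_def)
      have "sharp l \<in> sharp_terms ar D"
        using plain_subset_sharp[OF l(1), of D] f(2) ls
        by (auto simp: sharp_terms_def Fun_in_terms_over sharp_sig_def)
      then have "w (flat u) [] = peval (pol Pol (sharp l)) \<rho>"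
        using match val_subst[of "sharp l" \<sigma>] by (simp add: w_def u_def \<rho>_def ls)
      then show ?thesis
        using \<open>[] \<in> sharp_poss D u\<close> False by (simp add: sum.remove Z_def)
    qed
    ultimately show ?thesis
      unfolding ws C_def B'_def by (simp add: sum.distrib sum_distrib_right)
  qed

  have upper: "weight (result c D s \<pi> l \<sigma> r \<phi>) \<le>
      C + B' * peval (pol Pol (flat r)) \<rho> + (if c = NT then 0 else peval (Sum_pol D Pol r) \<rho>)"
    if vrf: "is_vrf l r \<phi>" and r: "r \<in> sharp_terms ar D" for r \<phi>
  proof -
    let ?t = "result c D s \<pi> l \<sigma> r \<phi>"
    let ?N = "new_poss c D l r u \<phi>"
    let ?y = "flat (subst \<sigma> r)"
    have finN: "finite ?N"
      unfolding u_def by (rule finite_subset[OF new_poss_defined[OF match vrf]]) simp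
    have y: "val ?y = peval (pol Pol (flat r)) \<rho>"
      using \<sigma> val_subst[of "flat r" \<sigma>] plain_subset_sharp[OF flat_in_plain_terms[of r]] r
      by (simp add: flat_subst \<rho>_def sharp_terms_def)
    have "sharp_poss D ?t = keep \<union> par \<union> (@) \<pi> ` ?N"
      unfolding sharp_poss_result[OF \<pi>s match vrf]
      by (auto simp: keep_def above_def par_def strict_prefix_def u_def)
    then have "weight ?t = (\<Sum>p\<in>keep \<union> par \<union> (@) \<pi> ` ?N. w (replace_at F \<pi> ?y) p)"
      by (simp add: weight_def w_def F_def flat_result[OF \<pi>s])
    also have "\<dots> = (\<Sum>p\<in>keep. w (replace_at F \<pi> ?y) p) + (\<Sum>p\<in>par. w (replace_at F \<pi> ?y) p) +
        (\<Sum>q\<in>?N. w (replace_at F \<pi> ?y) (\<pi> @ q))"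
      by (rule split_sum[OF keep finN])
    also have "(\<Sum>p\<in>keep. w (replace_at F \<pi> ?y) p) = (\<Sum>p\<in>keep. A p) + B' * val ?y"
      using AB keep by (simp add: subset_iff sum.distrib sum_distrib_right B'_def)
    also have "(\<Sum>p\<in>par. w (replace_at F \<pi> ?y) p) = (\<Sum>p\<in>par. w F p)"
      by (simp add: w_par)
    also have "(\<Sum>q\<in>?N. w (replace_at F \<pi> ?y) (\<pi> @ q)) = (\<Sum>q\<in>?N. w ?y q)"
      using F(2) by (simp add: w_def subt_at_replace_at_below)
    finally have wt: "weight ?t = (\<Sum>p\<in>keep. A p) + B' * val ?y + (\<Sum>p\<in>par. w F p) + (\<Sum>q\<in>?N. w ?y q)" .
    have PsiZ: "(\<Sum>q\<in>Psi D l u \<phi>. w ?y q) \<le> Z"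
      unfolding w_def Z_def by (rule sum_Psi_le) (use match vrf l(2) in \<open>auto simp: u_def\<close>)
    have "(\<Sum>q\<in>?N. w ?y q) \<le> (if c = NT then 0 else peval (Sum_pol D Pol r) \<rho>) + Z"
    proof (cases "c = NT")
      case True
      then show ?thesis using PsiZ by (simp add: new_poss_def)
    next
      case False
      then have N: "?N = sharp_poss D r \<union> Psi D l u \<phi>" by (simp add: new_poss_def Phi_def)
      \<comment> \<open>Counting a common position twice can only increase the right-hand
        side.\<close>
      have "(\<Sum>q\<in>?N. w ?y q) \<le> (\<Sum>q\<in>sharp_poss D r. w ?y q) + (\<Sum>q\<in>Psi D l u \<phi>. w ?y q)"
        using finN unfolding N by (subst sum.union_inter[symmetric]) auto
      also have "(\<Sum>q\<in>sharp_poss D r. w ?y q) = peval (Sum_pol D Pol r) \<rho>"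
        using sum_sharp_poss_subst[OF r \<sigma>] by (simp add: w_def \<rho>_def)
      finally show ?thesis using PsiZ False by simp
    qed
    then show ?thesis unfolding wt C_def y by simp
  qed
  have "c = AF \<longrightarrow> B' = 0" by (simp add: B'_def keep_def)
  then show ?thesis using lower upper by blast
qed

text \<open>The upper bounds of \<open>weight_result\<close> are averaged over the branches. The
  probabilities sum to 1, so \<open>C\<close> is preserved, and \<open>flat_le\<close> and
  \<open>sharp_le\<close> lead back to the lower bound for \<open>s\<close>.\<close>

lemma weight_step_le:
  fixes s :: "('f, 'v) atrm"
  assumes \<alpha>: "is_adp ar D \<alpha>" and step: "adp_step ar D \<alpha> c s \<mu>" and s: "s \<in> sharp_terms ar D"
    and sharp_le: "\<And>\<rho> :: 'v \<Rightarrow> nat. (\<Sum>(p, r) \<in># rhs \<alpha>. p * real (peval (Sum_pol D Pol r) \<rho>)) \<le>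
      real (peval (pol Pol (sharp (lhs \<alpha>))) \<rho>)"
    and flat_le: "\<And>\<rho> :: 'v \<Rightarrow> nat. flag \<alpha> \<Longrightarrow>
      (\<Sum>(p, r) \<in># rhs \<alpha>. p * real (peval (pol Pol (flat r)) \<rho>)) \<le> real (peval (pol Pol (lhs \<alpha>)) \<rho>)"
  shows "(\<Sum>(q, t) \<in># \<mu>. q * real (weight t)) \<le> real (weight s)"
proof -
  from step obtain \<sigma> \<pi> where \<sigma>: "is_subst ar \<sigma>" and \<pi>: "\<pi> \<in> defined_poss D s"
    and match: "flat (subt_at s \<pi>) = subst \<sigma> (lhs \<alpha>)"
    and c: "case_applies c (\<pi> \<in> sharp_poss D s) (flag \<alpha>)"
    and rel: "rel_mset (\<lambda>(p, r) (q, t). q = p \<and>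
         (\<exists>\<phi>. is_vrf (lhs \<alpha>) r \<phi> \<and> t = result c D s \<pi> (lhs \<alpha>) \<sigma> r \<phi>)) (rhs \<alpha>) \<mu>"
    unfolding adp_step_def by blast
  define \<rho> where "\<rho> x = val (\<sigma> x)" for x
  have l: "lhs \<alpha> \<in> plain_terms ar" "\<nexists>x. lhs \<alpha> = Var x"
    and sum1: "(\<Sum>(p, r) \<in># rhs \<alpha>. p) = 1"
    and rhs: "\<And>p r. (p, r) \<in># rhs \<alpha> \<Longrightarrow> 0 < p \<and> r \<in> sharp_terms ar D"
    using \<alpha> by (auto simp: is_adp_def)
  have "c = NT \<or> \<pi> \<in> sharp_poss D s" using c by (cases c) auto
  from weight_result[OF s \<pi> match l \<sigma> this] obtain C B where
    AF: "c = AF \<longrightarrow> B = 0" and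
    lower: "C + B * peval (pol Pol (lhs \<alpha>)) \<rho> +
      (if c = NT then 0 else peval (pol Pol (sharp (lhs \<alpha>))) \<rho>) \<le> weight s" and
    upper: "\<And>r \<phi>. is_vrf (lhs \<alpha>) r \<phi> \<Longrightarrow> r \<in> sharp_terms ar D \<Longrightarrow>
      weight (result c D s \<pi> (lhs \<alpha>) \<sigma> r \<phi>) \<le>
        C + B * peval (pol Pol (flat r)) \<rho> + (if c = NT then 0 else peval (Sum_pol D Pol r) \<rho>)"
    unfolding \<rho>_def by blast
  \<comment> \<open>Indicator of an annotated redex: only then does \<open>Sum_pol\<close>
    enter.\<close>
  define k :: real where "k = (if c = NT then 0 else 1)"
  have k: "0 \<le> k" by (simp add: k_def)
  let ?f = "\<lambda>r. real (peval (pol Pol (flat r)) \<rho>)"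
  let ?S = "\<lambda>r. real (peval (Sum_pol D Pol r) \<rho>)"
  have "(\<Sum>(q, t) \<in># \<mu>. q * real (weight t)) \<le>
      (\<Sum>(p, r) \<in># rhs \<alpha>. p * (real C + real B * ?f r + k * ?S r))"
  proof (rule rel_mset_sum_le[OF rel], clarsimp)
    fix p r \<phi> assume pr: "(p, r) \<in># rhs \<alpha>" and \<phi>: "is_vrf (lhs \<alpha>) r \<phi>"
    have "real (weight (result c D s \<pi> (lhs \<alpha>) \<sigma> r \<phi>)) \<le>
        real (C + B * peval (pol Pol (flat r)) \<rho> + (if c = NT then 0 else peval (Sum_pol D Pol r) \<rho>))"
      using upper[OF \<phi>] rhs[OF pr] of_nat_mono by blast
    also have "\<dots> = real C + real B * ?f r + k * ?S r" by (simp add: k_def)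
    finally show "p * real (weight (result c D s \<pi> (lhs \<alpha>) \<sigma> r \<phi>)) \<le> p * (real C + real B * ?f r + k * ?S r)"
      using rhs[OF pr] by (simp add: mult_left_mono)
  qed
  \<comment> \<open>Stated for an arbitrary multiset \<open>M\<close> so that induction
    applies.\<close>
  also have "(\<Sum>(p, r) \<in># M. p * (real C + real B * ?f r + k * ?S r)) =
      real C * (\<Sum>(p, r) \<in># M. p) + real B * (\<Sum>(p, r) \<in># M. p * ?f r) + k * (\<Sum>(p, r) \<in># M. p * ?S r)" for M
    by (induction M) (auto simp: algebra_simps)
  also have "real C * (\<Sum>(p, r) \<in># rhs \<alpha>. p) + real B * (\<Sum>(p, r) \<in># rhs \<alpha>. p * ?f r) +
      k * (\<Sum>(p, r) \<in># rhs \<alpha>. p * ?S r) \<le>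
      real C + real B * real (peval (pol Pol (lhs \<alpha>)) \<rho>) + k * real (peval (pol Pol (sharp (lhs \<alpha>))) \<rho>)"
  proof (intro add_mono)
    show "real B * (\<Sum>(p, r) \<in># rhs \<alpha>. p * ?f r) \<le> real B * real (peval (pol Pol (lhs \<alpha>)) \<rho>)"
    proof (cases "flag \<alpha>")
      case False
      \<comment> \<open>Both \<open>AT\<close> and \<open>NT\<close> demand the flag, so only the
        case with \<open>B = 0\<close> remains.\<close>
      then have "c = AF" using c by (cases c) auto
      then show ?thesis using AF by simp
    qed (intro mult_left_mono flat_le, auto)
    show "k * (\<Sum>(p, r) \<in># rhs \<alpha>. p * ?S r) \<le> k * real (peval (pol Pol (sharp (lhs \<alpha>))) \<rho>)"
      by (intro mult_left_mono sharp_le k)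
  qed (simp add: sum1)
  also have "\<dots> = real (C + B * peval (pol Pol (lhs \<alpha>)) \<rho> +
      (if c = NT then 0 else peval (pol Pol (sharp (lhs \<alpha>))) \<rho>))"
    by (simp add: k_def)
  also have "\<dots> \<le> real (weight s)" using lower of_nat_mono by blast
  finally show ?thesis .
qed

text \<open>Redex and reduct are compared with the same \<open>C\<close> and \<open>B\<close>, so
  the strict gap at the annotated redex survives in every context. For an unannotated redex this gap
  would not enter the weight.\<close>

lemma weight_step_decrease:
  fixes s :: "('f, 'v) atrm"
  assumes \<alpha>: "is_adp ar D \<alpha>" and step: "adp_step ar D \<alpha> c s \<mu>" and s: "s \<in> sharp_terms ar D"
    and c: "c \<noteq> NT" and pr: "(p, r) \<in># rhs \<alpha>"
    and sharp_less: "\<And>\<rho> :: 'v \<Rightarrow> nat. peval (Sum_pol D Pol r) \<rho> < peval (pol Pol (sharp (lhs \<alpha>))) \<rho>"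
    and flat_le: "\<And>\<rho> :: 'v \<Rightarrow> nat. flag \<alpha> \<Longrightarrow> peval (pol Pol (flat r)) \<rho> \<le> peval (pol Pol (lhs \<alpha>)) \<rho>"
  shows "\<exists>t. (p, t) \<in># \<mu> \<and> weight t < weight s"
proof -
  from step obtain \<sigma> \<pi> where \<sigma>: "is_subst ar \<sigma>" and \<pi>: "\<pi> \<in> defined_poss D s"
    and match: "flat (subt_at s \<pi>) = subst \<sigma> (lhs \<alpha>)"
    and ca: "case_applies c (\<pi> \<in> sharp_poss D s) (flag \<alpha>)"
    and rel: "rel_mset (\<lambda>(p, r) (q, t). q = p \<and>
         (\<exists>\<phi>. is_vrf (lhs \<alpha>) r \<phi> \<and> t = result c D s \<pi> (lhs \<alpha>) \<sigma> r \<phi>)) (rhs \<alpha>) \<mu>"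
    unfolding adp_step_def by blast
  define \<rho> where "\<rho> x = val (\<sigma> x)" for x
  have l: "lhs \<alpha> \<in> plain_terms ar" "\<nexists>x. lhs \<alpha> = Var x" and r: "r \<in> sharp_terms ar D"
    using \<alpha> pr by (auto simp: is_adp_def)
  have "c = NT \<or> \<pi> \<in> sharp_poss D s" using ca by (cases c) auto
  from weight_result[OF s \<pi> match l \<sigma> this] obtain C B where
    AF: "c = AF \<longrightarrow> B = 0" and
    lower: "C + B * peval (pol Pol (lhs \<alpha>)) \<rho> + peval (pol Pol (sharp (lhs \<alpha>))) \<rho> \<le> weight s" and
    upper: "\<And>\<phi>. is_vrf (lhs \<alpha>) r \<phi> \<Longrightarrow> weight (result c D s \<pi> (lhs \<alpha>) \<sigma> r \<phi>) \<le>
        C + B * peval (pol Pol (flat r)) \<rho> + peval (Sum_pol D Pol r) \<rho>"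
    using r c unfolding \<rho>_def by auto
  from rel pr obtain b where b: "b \<in># \<mu>" and
    "(\<lambda>(q, t). q = p \<and> (\<exists>\<phi>. is_vrf (lhs \<alpha>) r \<phi> \<and> t = result c D s \<pi> (lhs \<alpha>) \<sigma> r \<phi>)) b"
    by (rule rel_mset_obtain) simp
  then obtain \<phi> where \<phi>: "b = (p, result c D s \<pi> (lhs \<alpha>) \<sigma> r \<phi>)" "is_vrf (lhs \<alpha>) r \<phi>"
    by (cases b) auto
  have "B * peval (pol Pol (flat r)) \<rho> \<le> B * peval (pol Pol (lhs \<alpha>)) \<rho>"
  proof (cases "flag \<alpha>")
    case False
    then have "c = AF" using ca by (cases c) auto
    then show ?thesis using AF by simp
  qed (intro mult_le_mono flat_le, auto)
  then have "weight (result c D s \<pi> (lhs \<alpha>) \<sigma> r \<phi>) < weight s"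
    using upper[OF \<phi>(2)] lower sharp_less[of \<rho>] by linarith
  then show ?thesis using b \<phi>(1) by blast
qed

end

section \<open>Probability trees\<close>

text \<open>The probabilistic argument needs only the tree and its masses. It is instantiated with
  chain trees and with their cuts.\<close>

locale prob_tree =
  fixes V :: "'n set" and E :: "('n \<times> 'n) set" and r :: 'n and p :: "'n \<Rightarrow> real"
  assumes tree: "rooted_tree V E r"
    and prob_root: "p r = 1"
    and finite_ch: "v \<in> V \<Longrightarrow> finite {w. (v, w) \<in> E}"
    and prob_pos: "v \<in> V \<Longrightarrow> 0 < p v"
    and prob_ch: "v \<in> V \<Longrightarrow> {w. (v, w) \<in> E} \<noteq> {} \<Longrightarrow> (\<Sum>w | (v, w) \<in> E. p w) = p v"
begin

definition ch :: "'n \<Rightarrow> 'n set" where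
  "ch v = {w. (v, w) \<in> E}"

text \<open>Finite branching keeps each level finite, so the estimates are finite sums over levels;
  an infinite sum occurs only in \<open>leaf_mass\<close>.\<close>

definition level :: "nat \<Rightarrow> 'n set" where
  "level n = (E ^^ n) `` {r}"

definition inner_level :: "nat \<Rightarrow> 'n set" where
  "inner_level n = {v \<in> level n. ch v \<noteq> {}}"

definition leaf_level :: "nat \<Rightarrow> 'n set" where
  "leaf_level n = {v \<in> level n. ch v = {}}"

definition leaf_mass :: real where
  "leaf_mass = (\<Sum>\<^sub>\<infinity>v\<in>{v \<in> V. ch v = {}}. p v)"

lemma level_0: "level 0 = {r}"
  by (simp add: level_def)

lemma level_Suc: "level (Suc n) = (\<Union>v\<in>level n. ch v)"
  by (auto simp: level_def ch_def)

lemma edge_nodes: "(v, w) \<in> E \<Longrightarrow> v \<in> V \<and> w \<in> V"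
  using tree by (auto simp: rooted_tree_def)

lemma root_no_parent: "(v, r) \<notin> E"
  using tree by (auto simp: rooted_tree_def)

lemma unique_parent: "(u, w) \<in> E \<Longrightarrow> (v, w) \<in> E \<Longrightarrow> u = v"
  using tree unfolding rooted_tree_def by blast

lemma level_subset: "level n \<subseteq> V"
proof (induction n)
  case 0
  then show ?case using tree by (simp add: level_0 rooted_tree_def)
next
  case (Suc n)
  then show ?case using edge_nodes by (auto simp: level_Suc ch_def)
qed

lemma finite_level: "finite (level n)"
proof (induction n)
  case (Suc n)
  then show ?case using finite_ch level_subset[of n] by (auto simp: level_Suc ch_def)
qed (simp add: level_0)

lemma finite_inner_level [simp]: "finite (inner_level n)"
  using finite_level by (simp add: inner_level_def)

lemma finite_leaf_level [simp]: "finite (leaf_level n)"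
  using finite_level by (simp add: leaf_level_def)

lemma level_disjoint: "v \<in> level m \<Longrightarrow> v \<in> level n \<Longrightarrow> m = n"
proof (induction m arbitrary: v n)
  case 0
  then show ?case using root_no_parent by (cases n) (auto simp: level_0 level_Suc ch_def)
next
  case (Suc m)
  then obtain u where u: "u \<in> level m" "(u, v) \<in> E" by (auto simp: level_Suc ch_def)
  show ?case
  proof (cases n)
    case 0
    then show ?thesis using Suc.prems u root_no_parent by (auto simp: level_0)
  next
    case (Suc k)
    then obtain u' where "u' \<in> level k" "(u', v) \<in> E"
      using Suc.prems by (auto simp: level_Suc ch_def)
    then show ?thesis using Suc.IH[of u k] u unique_parent[of u v u'] \<open>n = Suc k\<close> by auto
  qed
qed

lemma nodes_eq_levels: "V = (\<Union>n. level n)"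
proof
  show "V \<subseteq> (\<Union>n. level n)"
    using tree by (auto simp: rooted_tree_def level_def rtrancl_power)
  show "(\<Union>n. level n) \<subseteq> V" using level_subset by blast
qed

lemma leaves_eq_levels: "{v \<in> V. ch v = {}} = (\<Union>n. leaf_level n)"
  using nodes_eq_levels by (auto simp: leaf_level_def)

lemma level_split: "level n = inner_level n \<union> leaf_level n" "inner_level n \<inter> leaf_level n = {}"
  by (auto simp: inner_level_def leaf_level_def)

lemma sum_level_split: "sum f (level n) = sum f (inner_level n) + sum f (leaf_level n)"
  for f :: "'n \<Rightarrow> real"
  using level_split[of n] by (simp add: sum.union_disjoint)

lemma sum_level_Suc: "sum f (level (Suc n)) = (\<Sum>v\<in>inner_level n. sum f (ch v))"
  for f :: "'n \<Rightarrow> real"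
proof -
  have "level (Suc n) = (\<Union>v\<in>inner_level n. ch v)"
    unfolding level_Suc inner_level_def by auto
  moreover have "finite (ch v)" if "v \<in> inner_level n" for v
    using that finite_ch level_subset[of n] by (auto simp: inner_level_def ch_def)
  moreover have "ch u \<inter> ch v = {}" if "u \<noteq> v" for u v
    using that unique_parent by (auto simp: ch_def)
  ultimately show ?thesis by (simp add: sum.UNION_disjoint)
qed

text \<open>The one-step inequality telescopes over the levels. \<open>g\<close> records the loss at
  inner nodes; a leaf passes nothing to the next level, so its share \<open>p v * f v\<close> is
  recorded separately.\<close>

lemma drift:
  fixes f g :: "'n \<Rightarrow> real"
  assumes "\<And>m v. N \<le> m \<Longrightarrow> v \<in> inner_level m \<Longrightarrow> (\<Sum>w\<in>ch v. p w * f w) + g v \<le> p v * f v"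
    and "N \<le> M"
  shows "(\<Sum>v\<in>level M. p v * f v) +
    (\<Sum>m=N..<M. (\<Sum>v\<in>inner_level m. g v) + (\<Sum>v\<in>leaf_level m. p v * f v)) \<le>
    (\<Sum>v\<in>level N. p v * f v)"
  using assms(2)
proof (induction M rule: dec_induct)
  case (step M)
  have "(\<Sum>v\<in>inner_level M. \<Sum>w\<in>ch v. p w * f w) + (\<Sum>v\<in>inner_level M. g v) \<le>
      (\<Sum>v\<in>inner_level M. p v * f v)"
    unfolding sum.distrib[symmetric] by (rule sum_mono) (use assms(1) step in auto)
  then show ?case
    using step sum_level_split[of "\<lambda>v. p v * f v" M] by (simp add: sum_level_Suc)
qed simp

lemma mass_split: "(\<Sum>v\<in>level M. p v) + (\<Sum>m<M. \<Sum>v\<in>leaf_level m. p v) = 1"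
proof (induction M)
  case (Suc M)
  have "(\<Sum>v\<in>inner_level M. sum p (ch v)) = (\<Sum>v\<in>inner_level M. p v)"
    by (rule sum.cong) (use prob_ch level_subset[of M] in \<open>auto simp: inner_level_def ch_def\<close>)
  then show ?case
    using Suc sum_level_split[of p M] by (simp add: sum_level_Suc)
qed (simp add: level_0 prob_root)

lemma prob_level_nonneg: "v \<in> level n \<Longrightarrow> 0 \<le> p v"
  using prob_pos level_subset[of n] by (auto intro: less_imp_le)

lemma level_mass_le_1: "(\<Sum>v\<in>level M. p v) \<le> 1"
proof -
  have "0 \<le> (\<Sum>m<M. \<Sum>v\<in>leaf_level m. p v)"
    by (intro sum_nonneg) (auto simp: leaf_level_def intro: prob_level_nonneg)
  then show ?thesis using mass_split[of M] by linarith
qed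

section \<open>Leaf mass as a limit of finite sums\<close>

lemma sum_leaf_levels:
  "(\<Sum>m<M. \<Sum>v\<in>leaf_level m. f v) = sum f (\<Union>m<M. leaf_level m)" for f :: "'n \<Rightarrow> real"
proof -
  have "leaf_level m \<inter> leaf_level n = {}" if "m \<noteq> n" for m n
    using level_disjoint that by (auto simp: leaf_level_def)
  then show ?thesis by (simp add: sum.UNION_disjoint)
qed

lemma leaf_partial_le_1: "(\<Sum>m<M. \<Sum>v\<in>leaf_level m. p v) \<le> 1"
proof -
  have "0 \<le> (\<Sum>v\<in>level M. p v)" by (intro sum_nonneg prob_level_nonneg)
  then show ?thesis using mass_split[of M] by linarith
qed

lemma finite_leaves_subset:
  assumes "finite F" "F \<subseteq> {v \<in> V. ch v = {}}"
  shows "\<exists>M. F \<subseteq> (\<Union>m<M. leaf_level m)"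
  using assms
proof (induction F rule: finite_induct)
  case (insert v F)
  then have "F \<subseteq> {v \<in> V. ch v = {}}" by simp
  then obtain M where M: "F \<subseteq> (\<Union>m<M. leaf_level m)" using insert.IH by meson
  from insert obtain n where n: "v \<in> leaf_level n" unfolding leaves_eq_levels by auto
  have "(\<Union>m<M. leaf_level m) \<subseteq> (\<Union>m<max M (Suc n). leaf_level m)"
    by (rule UN_mono) auto
  moreover have "v \<in> (\<Union>m<max M (Suc n). leaf_level m)"
    using n by (intro UN_I[of n]) (simp_all add: less_max_iff_disj)
  ultimately have "insert v F \<subseteq> (\<Union>m<max M (Suc n). leaf_level m)"
    using M order_trans unfolding insert_subset by metis
  then show ?case by (rule exI)
qed simp

lemma finite_leaf_sum_le:
  assumes "finite F" "F \<subseteq> {v \<in> V. ch v = {}}"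
  shows "\<exists>M. sum p F \<le> (\<Sum>m<M. \<Sum>v\<in>leaf_level m. p v)"
proof -
  obtain M where M: "F \<subseteq> (\<Union>m<M. leaf_level m)" using finite_leaves_subset[OF assms] by blast
  have "sum p F \<le> sum p (\<Union>m<M. leaf_level m)"
  proof (rule sum_mono2[OF _ M])
    show "0 \<le> p v" if "v \<in> (\<Union>m<M. leaf_level m) - F" for v
      using that by (auto simp: leaf_level_def intro: prob_level_nonneg)
  qed simp
  then show ?thesis unfolding sum_leaf_levels[symmetric] by blast
qed

lemma summable_leaves: "p summable_on {v \<in> V. ch v = {}}"
proof (rule nonneg_bdd_above_summable_on)
  show "bdd_above (sum p ` {F. F \<subseteq> {v \<in> V. ch v = {}} \<and> finite F})"
  proof (rule bdd_aboveI2[of _ _ 1])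
    fix F assume "F \<in> {F. F \<subseteq> {v \<in> V. ch v = {}} \<and> finite F}"
    then show "sum p F \<le> 1"
      using finite_leaf_sum_le[of F] leaf_partial_le_1 order_trans by blast
  qed
qed (use prob_pos in \<open>auto intro: less_imp_le\<close>)

lemma leaf_partial_le: "(\<Sum>m<M. \<Sum>v\<in>leaf_level m. p v) \<le> leaf_mass"
  unfolding leaf_mass_def sum_leaf_levels
  by (rule finite_sum_le_infsum[OF summable_leaves])
     (use leaves_eq_levels prob_pos in \<open>auto intro: less_imp_le\<close>)

lemma leaf_mass_le:
  assumes "\<And>M. (\<Sum>m<M. \<Sum>v\<in>leaf_level m. p v) \<le> b"
  shows "leaf_mass \<le> b"
  unfolding leaf_mass_def
proof (rule infsum_le_finite_sums[OF summable_leaves])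
  fix F assume "finite F" "F \<subseteq> {v \<in> V. ch v = {}}"
  then show "sum p F \<le> b"
    using finite_leaf_sum_le[of F] assms order_trans by blast
qed

lemma leaf_mass_le_1: "leaf_mass \<le> 1"
  by (rule leaf_mass_le) (rule leaf_partial_le_1)

end

text \<open>Every node has a unique depth and, unless it is the root, a unique parent, so recursion
  on the depth works. It serves to relabel a chain tree from the root downwards.\<close>

lemma (in prob_tree) tree_recursion:
  "\<exists>h. h r = x \<and> (\<forall>v w. (v, w) \<in> E \<longrightarrow> h w = G v (h v) w)"
proof -
  define parent where "parent w = (THE v. (v, w) \<in> E)" for w
  have parent: "parent w = v" if "(v, w) \<in> E" for v w
    unfolding parent_def using that unique_parent by (intro the_equality)
  \<comment> \<open>\<open>F n\<close> is meant for nodes at depth \<open>n\<close> only.\<close>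
  define F where "F = rec_nat (\<lambda>_. x) (\<lambda>_ h w. G (parent w) (h (parent w)) w)"
  define depth where "depth v = (THE n. v \<in> level n)" for v
  have depth: "depth v = n" if "v \<in> level n" for v n
    unfolding depth_def using that level_disjoint by (intro the_equality)
  define h where "h v = F (depth v) v" for v
  have "h w = G v (h v) w" if vw: "(v, w) \<in> E" for v w
  proof -
    obtain n where n: "v \<in> level n" using edge_nodes[OF vw] nodes_eq_levels by blast
    then have "w \<in> level (Suc n)" using vw unfolding level_Suc ch_def by blast
    then show ?thesis using n by (simp add: h_def depth parent[OF vw] F_def)
  qed
  moreover have "h r = x" by (simp add: h_def depth[of r 0] level_0 F_def)
  ultimately show ?thesis by blast
qed

section \<open>Cutting a tree\<close>

text \<open>The nodes in \<open>K\<close> become leaves.\<close>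

definition cut_nodes :: "('n \<times> 'n) set \<Rightarrow> 'n \<Rightarrow> 'n set \<Rightarrow> 'n set" where
  "cut_nodes E r K = {v. (r, v) \<in> {(a, b) \<in> E. a \<notin> K}\<^sup>*}"

text \<open>Edges whose source has become unreachable go too, since the remaining edges must lie
  within \<open>cut_nodes\<close>.\<close>

definition cut_edges :: "('n \<times> 'n) set \<Rightarrow> 'n \<Rightarrow> 'n set \<Rightarrow> ('n \<times> 'n) set" where
  "cut_edges E r K = {(a, b) \<in> E. a \<notin> K \<and> a \<in> cut_nodes E r K}"

lemma cut_nodes_step: "a \<in> cut_nodes E r K \<Longrightarrow> (a, b) \<in> E \<Longrightarrow> a \<notin> K \<Longrightarrow> b \<in> cut_nodes E r K"
  unfolding cut_nodes_def by (auto intro: rtrancl_into_rtrancl)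

lemma cut_nodes_reachable: "v \<in> cut_nodes E r K \<Longrightarrow> (r, v) \<in> (cut_edges E r K)\<^sup>*"
  unfolding cut_nodes_def mem_Collect_eq
proof (induction rule: rtrancl_induct)
  case (step a b)
  then have "(a, b) \<in> cut_edges E r K" by (auto simp: cut_edges_def cut_nodes_def)
  then show ?case using step by (auto intro: rtrancl_into_rtrancl)
qed simp

lemma cut_nodes_subset:
  assumes "rooted_tree V E r"
  shows "cut_nodes E r K \<subseteq> V"
proof
  fix v assume "v \<in> cut_nodes E r K"
  then have "(r, v) \<in> {(a, b) \<in> E. a \<notin> K}\<^sup>*" by (simp add: cut_nodes_def)
  then show "v \<in> V" using assms by (induction rule: rtrancl_induct) (auto simp: rooted_tree_def)
qed

lemma rooted_tree_cut:
  assumes "rooted_tree V E r"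
  shows "rooted_tree (cut_nodes E r K) (cut_edges E r K) r"
proof -
  have "cut_edges E r K \<subseteq> cut_nodes E r K \<times> cut_nodes E r K"
    using cut_nodes_step by (fastforce simp: cut_edges_def)
  moreover have "cut_edges E r K \<subseteq> E" by (auto simp: cut_edges_def)
  moreover have "r \<in> cut_nodes E r K" by (simp add: cut_nodes_def)
  ultimately show ?thesis
    using assms cut_nodes_reachable[of _ E r K] unfolding rooted_tree_def
    by (intro conjI allI impI ballI) (assumption | blast)+
qed

lemma cut_children:
  "v \<in> cut_nodes E r K \<Longrightarrow> {w. (v, w) \<in> cut_edges E r K} = (if v \<in> K then {} else {w. (v, w) \<in> E})"
  by (auto simp: cut_edges_def)

text \<open>A remaining node keeps all of its children or none, so mass is still conserved at inner
  nodes.\<close>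

lemma (in prob_tree) prob_tree_cut: "prob_tree (cut_nodes E r K) (cut_edges E r K) r p"
proof
  show "rooted_tree (cut_nodes E r K) (cut_edges E r K) r"
    using tree by (rule rooted_tree_cut)
next
  fix v assume v: "v \<in> cut_nodes E r K"
  then have "v \<in> V" using cut_nodes_subset[OF tree] by blast
  then show "finite {w. (v, w) \<in> cut_edges E r K}" "0 < p v"
    using finite_ch prob_pos by (auto simp: cut_children[OF v])
  show "(\<Sum>w | (v, w) \<in> cut_edges E r K. p w) = p v" if "{w. (v, w) \<in> cut_edges E r K} \<noteq> {}"
    using that prob_ch[OF \<open>v \<in> V\<close>] unfolding cut_children[OF v] by (auto split: if_splits)
qed (rule prob_root)

section \<open>Recurrent decrease forces termination\<close>

text \<open>The last summand quantifies the strict concavity of \<open>x \<mapsto> 1 - 1/(1+x)\<close>.\<close>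

lemma inverse_tangent:
  fixes y z :: real
  assumes "0 < y" "0 < z"
  shows "1 / z = 1 / y - (z - y) / y^2 + (z - y)^2 / (y^2 * z)"
  using assms by (simp add: field_simps power2_eq_square power3_eq_cube)

text \<open>\<open>inverse_tangent\<close> at \<open>y = 1 + x\<close> is averaged over
  \<open>S\<close>. The linear term has the right sign by \<open>drift\<close>, and the remainders
  \<open>e w\<close> are nonnegative; if \<open>b\<close> holds, the remainder of one branch alone
  pays for the extra summand.\<close>

lemma concave_drift:
  fixes p W :: "'n \<Rightarrow> real"
  assumes fin: "finite S" and p: "\<And>w. w \<in> S \<Longrightarrow> 0 \<le> p w" and P: "(\<Sum>w\<in>S. p w) = P"
    and W: "\<And>w. w \<in> S \<Longrightarrow> 0 \<le> W w" "0 \<le> x" and drift: "(\<Sum>w\<in>S. p w * W w) \<le> P * x"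
    and strict: "b \<Longrightarrow> \<exists>w\<in>S. c * P \<le> p w \<and> W w + 1 \<le> x"
  shows "(\<Sum>w\<in>S. p w * (1 - 1 / (1 + W w))) + (if b then P * (c / (1 + x)^3) else 0) \<le> P * (1 - 1 / (1 + x))"
proof -
  define y where "y = 1 + x"
  have y: "0 < y" using W(2) by (simp add: y_def)
  define e where "e w = (1 + W w - y)^2 / (y^2 * (1 + W w))" for w
  have e0: "0 \<le> e w" if "w \<in> S" for w using W(1)[OF that] y by (simp add: e_def)
  have "(\<Sum>w\<in>S. p w * (1 - 1 / (1 + W w))) =
      (\<Sum>w\<in>S. p w * (1 - 1 / y) + (p w * W w - p w * x) / y^2 - p w * e w)"
  proof (rule sum.cong[OF refl])
    fix w assume "w \<in> S"
    then have *: "1 / (1 + W w) = 1 / y - (1 + W w - y) / y^2 + e w"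
      unfolding e_def by (intro inverse_tangent) (use W y in \<open>auto intro: add_pos_nonneg\<close>)
    show "p w * (1 - 1 / (1 + W w)) = p w * (1 - 1 / y) + (p w * W w - p w * x) / y^2 - p w * e w"
      unfolding * by (simp add: y_def algebra_simps diff_divide_distrib)
  qed
  also have "\<dots> = P * (1 - 1 / y) + ((\<Sum>w\<in>S. p w * W w) - P * x) / y^2 - (\<Sum>w\<in>S. p w * e w)"
    by (simp add: sum_subtractf sum.distrib P[symmetric] sum_distrib_right flip: sum_divide_distrib)
  also have "\<dots> \<le> P * (1 - 1 / y) - (\<Sum>w\<in>S. p w * e w)"
    using drift y by (simp add: divide_nonpos_pos)
  finally have *: "(\<Sum>w\<in>S. p w * (1 - 1 / (1 + W w))) \<le> P * (1 - 1 / y) - (\<Sum>w\<in>S. p w * e w)" .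
  have "(if b then P * (c / y^3) else 0) \<le> (\<Sum>w\<in>S. p w * e w)"
  proof (cases b)
    case True
    then obtain w where w: "w \<in> S" "c * P \<le> p w" "W w + 1 \<le> x" using strict by blast
    \<comment> \<open>A drop by at least 1 makes the squared difference at least 1, and the
      denominator is at most \<open>y^3\<close> because \<open>1 + W w \<le> y\<close>.\<close>
    have "1 / y^3 \<le> e w"
    proof -
      have z: "0 < 1 + W w" "1 + W w \<le> y" using W(1)[OF w(1)] w(3) by (auto simp: y_def)
      have "1 \<le> (1 + W w - y)^2"
        using w(3) power_mono[of 1 "y - (1 + W w)" 2] by (simp add: y_def power2_commute)
      moreover have "y^2 * (1 + W w) \<le> y^3"
        using z y by (simp add: power3_eq_cube power2_eq_square)
      ultimately show ?thesis
        unfolding e_def using z y by (intro frac_le) auto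
    qed
    then have "P * (c / y^3) \<le> p w * e w"
      using w(2) y p[OF w(1)] mult_mono[OF w(2), of "1 / y^3" "e w"] by (simp add: mult.commute)
    also have "\<dots> \<le> (\<Sum>w\<in>S. p w * e w)"
      by (rule member_le_sum) (use fin w(1) p e0 in auto)
    finally show ?thesis using True by simp
  qed (use p e0 in \<open>auto intro: sum_nonneg\<close>)
  then show ?thesis using * unfolding y_def by linarith
qed

context prob_tree
begin

text \<open>The potential \<open>1 - 1 / (1 + W v)\<close> lies between 0 and 1, so it cannot lose
  more than the mass at level \<open>N\<close>. The bound is thus independent of the size of
  \<open>W\<close>.\<close>

lemma strict_drift:
  fixes W :: "'n \<Rightarrow> real"
  assumes W: "\<And>v. 0 \<le> W v"
    and drift_W: "\<And>m v. N \<le> m \<Longrightarrow> v \<in> inner_level m \<Longrightarrow> (\<Sum>w\<in>ch v. p w * W w) \<le> p v * W v"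
    and strict: "\<And>m v. N \<le> m \<Longrightarrow> v \<in> inner_level m \<Longrightarrow> v \<in> A \<Longrightarrow>
      \<exists>w\<in>ch v. c * p v \<le> p w \<and> W w + 1 \<le> W v"
    and "N \<le> M"
  shows "(\<Sum>m=N..<M. \<Sum>v\<in>inner_level m. if v \<in> A then p v * (c / (1 + W v)^3) else 0) \<le> 1"
proof -
  define f where "f v = 1 - 1 / (1 + W v)" for v
  have f: "0 \<le> f v" "f v \<le> 1" for v
    using W[of v] by (auto simp: f_def divide_simps)
  define g where "g v = (if v \<in> A then p v * (c / (1 + W v)^3) else 0)" for v
  have "(\<Sum>w\<in>ch v. p w * f w) + g v \<le> p v * f v" if "N \<le> m" "v \<in> inner_level m" for m v
  proof -
    have v: "v \<in> V" "ch v \<noteq> {}" using that(2) level_subset by (auto simp: inner_level_def)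
    show ?thesis
      unfolding f_def g_def
    proof (rule concave_drift)
      show "finite (ch v)" using finite_ch[OF v(1)] by (simp add: ch_def)
      show "(\<Sum>w\<in>ch v. p w) = p v" using prob_ch[OF v(1)] v(2) by (simp add: ch_def)
      show "0 \<le> p w" if "w \<in> ch v" for w
        using that prob_pos edge_nodes by (auto simp: ch_def intro: less_imp_le)
    qed (use W drift_W[OF that] strict[OF that] in auto)
  qed
  from drift[of N f g, OF this \<open>N \<le> M\<close>]
  have "(\<Sum>v\<in>level M. p v * f v) +
    (\<Sum>m=N..<M. (\<Sum>v\<in>inner_level m. g v) + (\<Sum>v\<in>leaf_level m. p v * f v)) \<le>
    (\<Sum>v\<in>level N. p v * f v)" .
  moreover have "0 \<le> (\<Sum>v\<in>level M. p v * f v)"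
    by (intro sum_nonneg mult_nonneg_nonneg f prob_level_nonneg)
  moreover have "0 \<le> (\<Sum>m=N..<M. \<Sum>v\<in>leaf_level m. p v * f v)"
    by (intro sum_nonneg mult_nonneg_nonneg f) (auto simp: leaf_level_def intro: prob_level_nonneg)
  moreover have "(\<Sum>v\<in>level N. p v * f v) \<le> (\<Sum>v\<in>level N. p v)"
    by (rule sum_mono) (use f prob_level_nonneg in \<open>auto intro: mult_left_le\<close>)
  ultimately show ?thesis
    using level_mass_le_1[of N] by (simp add: sum.distrib g_def)
qed

text \<open>
  \<open>W\<close> is a supermartingale beyond level \<open>N\<close> that decreases by 1 with probability at least \<open>c\<close> at
  each node of \<open>A\<close>. If non-termination had positive mass \<open>q\<close>, then the nodes of \<open>A\<close> that are hit
  first after level \<open>n\<close> would have mass at least \<open>q/2\<close> for every \<open>n\<close>, and \<open>W\<close> would be bounded on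
  half of them. This contradicts \<open>strict_drift\<close>.
\<close>

theorem leaf_mass_eq_1:
  fixes W :: "'n \<Rightarrow> real"
  assumes W: "\<And>v. 0 \<le> W v" and c: "0 < c" and A: "\<And>v. v \<in> A \<Longrightarrow> ch v \<noteq> {}"
    and drift_W: "\<And>m v. N \<le> m \<Longrightarrow> v \<in> inner_level m \<Longrightarrow> (\<Sum>w\<in>ch v. p w * W w) \<le> p v * W v"
    and strict_W: "\<And>m v. N \<le> m \<Longrightarrow> v \<in> inner_level m \<Longrightarrow> v \<in> A \<Longrightarrow>
      \<exists>w\<in>ch v. c * p v \<le> p w \<and> W w + 1 \<le> W v"
    and cut: "\<And>n K. N \<le> n \<Longrightarrow> K = A \<inter> (\<Union>m\<in>{n..}. level m) \<Longrightarrow>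
      prob_tree.leaf_mass (cut_nodes E r K) (cut_edges E r K) p = 1"
  shows "leaf_mass = 1"
proof (rule ccontr)
  assume "leaf_mass \<noteq> 1"
  define q where "q = 1 - leaf_mass"
  have q: "0 < q" using leaf_mass_le_1 \<open>leaf_mass \<noteq> 1\<close> by (simp add: q_def)
  define g where "g v = (if v \<in> A then p v * (c / (1 + W v)^3) else 0)" for v
  define a where "a m = (\<Sum>v\<in>inner_level m. g v)" for m
  have g0: "0 \<le> g v" if "v \<in> level m" for v m
    using prob_level_nonneg[OF that] c W[of v] by (simp add: g_def)
  have a0: "0 \<le> a m" for m
    unfolding a_def by (rule sum_nonneg) (auto simp: inner_level_def intro: g0)
  define C where "C = (\<Sum>v\<in>level N. p v * W v)"
  have C: "0 \<le> C" unfolding C_def by (intro sum_nonneg mult_nonneg_nonneg W prob_level_nonneg)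
  \<comment> \<open>Threshold for Markov's inequality: mass with \<open>W\<close> above
    \<open>K0\<close> is at most \<open>C / K0 \<le> q / 4\<close>. Adding 1 keeps \<open>K0\<close>
    positive when \<open>C = 0\<close>.\<close>
  define K0 where "K0 = 4 * C / q + 1"
  have K0: "0 < K0" "C / K0 \<le> q / 4"
    using C q by (auto simp: K0_def field_simps intro: add_nonneg_pos)
  \<comment> \<open>A lower bound for the loss per unit of mass as long as \<open>W\<close> is at
    most \<open>K0\<close>.\<close>
  define d where "d = c / (1 + K0)^3"
  have d: "0 < d" using c K0 by (simp add: d_def)

  \<comment> \<open>All losses together are at most 1, so those below a late level are arbitrarily
    small; \<open>d * q / 4\<close> is what the final estimate contradicts.\<close>
  have "summable (\<lambda>m. if m < N then 0 else a m)"
  proof (rule summableI_nonneg_bounded)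
    fix M
    have "(\<Sum>m<M. if m < N then 0 else a m) = (\<Sum>m=N..<M. a m)"
      by (rule sum.mono_neutral_cong_right) auto
    also have "\<dots> \<le> 1"
      using strict_drift[OF W drift_W strict_W, where N = N and M = M]
      by (cases "N \<le> M") (auto simp: a_def g_def)
    finally show "(\<Sum>m<M. if m < N then 0 else a m) \<le> 1" .
  qed (use a0 in auto)
  then obtain n0 where n0: "\<And>m n. n0 \<le> m \<Longrightarrow> norm (\<Sum>i=m..<n. if i < N then 0 else a i) < d * q / 4"
    using d q unfolding summable_Cauchy by (metis divide_pos_pos mult_pos_pos zero_less_numeral)
  define n where "n = max n0 N"
  have n: "n0 \<le> n" "N \<le> n" by (auto simp: n_def)
  have tail: "(\<Sum>m=n..<M. a m) < d * q / 4" for M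
  proof -
    have "(\<Sum>m=n..<M. if m < N then 0 else a m) = (\<Sum>m=n..<M. a m)"
      by (rule sum.cong) (use n in auto)
    then show ?thesis using n0[OF n(1), of M] by simp
  qed

  define K where "K = A \<inter> (\<Union>m\<in>{n..}. level m)"
  interpret T: prob_tree "cut_nodes E r K" "cut_edges E r K" r p
    by (rule prob_tree_cut)
  have mass1: "T.leaf_mass = 1" using cut[OF n(2) K_def] .
  have T_level: "T.level m \<subseteq> level m" for m
  proof (induction m)
    case (Suc m)
    moreover have "T.ch v \<subseteq> ch v" for v
      unfolding T.ch_def ch_def by (auto simp: cut_edges_def)
    ultimately show ?case unfolding T.level_Suc level_Suc by (intro UN_mono)
  qed (simp add: T.level_0 level_0)
  have T_ch: "T.ch v = (if v \<in> K then {} else ch v)" if "v \<in> T.level m" for v m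
    unfolding T.ch_def ch_def using T.level_subset[of m] that by (intro cut_children) blast
  \<comment> \<open>The nodes where a path meets \<open>A\<close> for the first time at depth at
    least \<open>n\<close>, sorted by level. They are leaves of the cut tree but inner nodes of the
    original one.\<close>
  define H where "H m = K \<inter> T.level m" for m
  have finH: "finite (H m)" for m by (simp add: H_def T.finite_level)
  have H_empty: "H m = {}" if "m < n" for m
  proof (rule ccontr)
    assume "H m \<noteq> {}"
    then obtain v k where "v \<in> T.level m" "n \<le> k" "v \<in> level k"
      unfolding H_def K_def by blast
    then show False using T_level[of m] level_disjoint[of v m k] that by auto
  qed
  have H_inner: "H m \<subseteq> inner_level m" "H m \<subseteq> A" for m
    using A T_level[of m] unfolding H_def K_def inner_level_def by blast+
  have H_leaf: "H m \<subseteq> T.leaf_level m" for m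
  proof
    fix v assume "v \<in> H m"
    then show "v \<in> T.leaf_level m" using T_ch[of v m] by (simp add: H_def T.leaf_level_def)
  qed
  have T_leaf: "T.leaf_level m \<subseteq> leaf_level m \<union> H m" for m
  proof
    fix v assume v: "v \<in> T.leaf_level m"
    then have "v \<in> T.level m" "v \<in> level m" "T.ch v = {}"
      using T_level[of m] by (auto simp: T.leaf_level_def)
    then show "v \<in> leaf_level m \<union> H m"
      using T_ch[of v m] by (cases "v \<in> K") (auto simp: H_def leaf_level_def)
  qed

  have "\<exists>M. 1 - q / 2 < (\<Sum>m<M. \<Sum>v\<in>T.leaf_level m. p v)"
  proof (rule ccontr)
    assume "\<not> ?thesis"
    then have "T.leaf_mass \<le> 1 - q / 2" by (intro T.leaf_mass_le) (simp add: not_less)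
    then show False using mass1 q by simp
  qed
  then obtain M where M: "1 - q / 2 < (\<Sum>m<M. \<Sum>v\<in>T.leaf_level m. p v)" by (rule exE)
  have "(\<Sum>m<M. \<Sum>v\<in>T.leaf_level m. p v) \<le> (\<Sum>m<M. (\<Sum>v\<in>leaf_level m. p v) + (\<Sum>v\<in>H m. p v))"
  proof (rule sum_mono)
    fix m
    have nn: "0 \<le> p v" if "v \<in> leaf_level m \<union> H m" for v
      using that H_inner(1)[of m] prob_level_nonneg[of v m] by (auto simp: leaf_level_def inner_level_def)
    have "(\<Sum>v\<in>T.leaf_level m. p v) \<le> (\<Sum>v\<in>leaf_level m \<union> H m. p v)"
      by (rule sum_mono2) (use T_leaf finH nn in auto)
    also have "\<dots> = (\<Sum>v\<in>leaf_level m. p v) + (\<Sum>v\<in>H m. p v)"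
      using H_inner(1)[of m] level_split(2)[of m] finH by (intro sum.union_disjoint) auto
    finally show "(\<Sum>v\<in>T.leaf_level m. p v) \<le> (\<Sum>v\<in>leaf_level m. p v) + (\<Sum>v\<in>H m. p v)" .
  qed
  also have "\<dots> \<le> leaf_mass + (\<Sum>m<M. \<Sum>v\<in>H m. p v)"
    using leaf_partial_le[of M] by (simp add: sum.distrib)
  also have "(\<Sum>m<M. \<Sum>v\<in>H m. p v) = (\<Sum>m=n..<M. \<Sum>v\<in>H m. p v)"
    by (rule sum.mono_neutral_right) (use H_empty in auto)
  finally have mass: "(\<Sum>m<M. \<Sum>v\<in>T.leaf_level m. p v) \<le> leaf_mass + (\<Sum>m=n..<M. \<Sum>v\<in>H m. p v)" .
  have "q / 2 < x" if "s \<le> leaf_mass + x" "1 - q / 2 < s" for x s :: real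
    using that by (simp add: q_def field_simps)
  \<comment> \<open>The cut tree has leaf mass above \<open>1 - q / 2\<close> before level
    \<open>M\<close>; the original leaves supply at most \<open>1 - q\<close> of it.\<close>
  from this[OF mass M] have X: "q / 2 < (\<Sum>m=n..<M. \<Sum>v\<in>H m. p v)" .
  then have NM: "n \<le> M" using q by (cases "n \<le> M") auto

  \<comment> \<open>The supermartingale \<open>W\<close> is stopped at \<open>H\<close>, so its mean
    there cannot exceed its mean at level \<open>N\<close>.\<close>
  have Y: "(\<Sum>m=n..<M. \<Sum>v\<in>H m. p v * W v) \<le> C"
  proof -
    have pW: "0 \<le> p v * W v" if "v \<in> level m" for v m
      using prob_level_nonneg[OF that] W by simp
    have "(\<Sum>w\<in>T.ch v. p w * W w) + 0 \<le> p v * W v" if "N \<le> m" "v \<in> T.inner_level m" for m v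
      using that T_ch[of v m] T_level[of m] drift_W[of m v]
      by (auto simp: T.inner_level_def inner_level_def split: if_splits)
    from T.drift[of N W "\<lambda>_. 0", OF this order_trans[OF n(2) NM]]
    have "(\<Sum>v\<in>T.level M. p v * W v) + (\<Sum>m=N..<M. \<Sum>v\<in>T.leaf_level m. p v * W v) \<le>
      (\<Sum>v\<in>T.level N. p v * W v)" by simp
    moreover have "0 \<le> (\<Sum>v\<in>T.level M. p v * W v)"
      by (rule sum_nonneg) (rule pW, erule T_level[THEN subsetD])
    moreover have "(\<Sum>v\<in>T.level N. p v * W v) \<le> C"
      unfolding C_def by (rule sum_mono2[OF finite_level T_level]) (rule pW, erule DiffD1)
    moreover have "(\<Sum>m=n..<M. \<Sum>v\<in>H m. p v * W v) \<le> (\<Sum>m=N..<M. \<Sum>v\<in>T.leaf_level m. p v * W v)"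
    proof -
      have nn: "0 \<le> p v * W v" if "v \<in> T.leaf_level m" for v m
        using that pW[of v m] T_level[of m] by (auto simp: T.leaf_level_def)
      have "(\<Sum>m=n..<M. \<Sum>v\<in>H m. p v * W v) \<le> (\<Sum>m=n..<M. \<Sum>v\<in>T.leaf_level m. p v * W v)"
        by (intro sum_mono sum_mono2) (use H_leaf nn in auto)
      also have "\<dots> \<le> (\<Sum>m=N..<M. \<Sum>v\<in>T.leaf_level m. p v * W v)"
        by (rule sum_mono2) (use n nn in \<open>auto intro: sum_nonneg\<close>)
      finally show ?thesis .
    qed
    ultimately show ?thesis by linarith
  qed

  \<comment> \<open>Markov's inequality in linear form: \<open>d * (1 - x / K0)\<close> is at most
    \<open>d\<close> up to \<open>K0\<close> and nonpositive beyond, hence below the loss at every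
    \<open>x\<close>. Being linear in \<open>W\<close>, it sums directly to an expression in
    \<open>X\<close> and \<open>Y\<close>.\<close>
  have pointwise: "d * p v - d / K0 * (p v * W v) \<le> g v" if "v \<in> H m" for v m
  proof -
    have v: "v \<in> A" "0 \<le> p v"
      using that H_inner[of m] prob_level_nonneg[of v m] by (auto simp: inner_level_def)
    have "d * (1 - W v / K0) \<le> c / (1 + W v)^3"
    proof (cases "W v \<le> K0")
      case True
      have "d * (1 - W v / K0) \<le> d"
        using d K0 W[of v] by (simp add: mult_left_le)
      also have "d \<le> c / (1 + W v)^3"
        unfolding d_def using True W[of v] c by (intro divide_left_mono power_mono mult_pos_pos) auto
      finally show ?thesis .
    next
      case False
      then have "d * (1 - W v / K0) \<le> 0"
        using d K0 by (intro mult_nonneg_nonpos) auto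
      also have "0 \<le> c / (1 + W v)^3" using c W[of v] by simp
      finally show ?thesis .
    qed
    from mult_left_mono[OF this v(2)] show ?thesis
      using v(1) by (simp add: g_def algebra_simps)
  qed
  \<comment> \<open>Of the mass \<open>q / 2\<close>, at most \<open>q / 4\<close> is lost to large
    values of \<open>W\<close>.\<close>
  have "d * q / 4 \<le> d * (q / 2) - d * (C / K0)"
    using mult_left_mono[OF K0(2), of d] d by simp
  also have "\<dots> \<le> d * (\<Sum>m=n..<M. \<Sum>v\<in>H m. p v) - d / K0 * (\<Sum>m=n..<M. \<Sum>v\<in>H m. p v * W v)"
  proof (rule diff_mono)
    show "d * (q / 2) \<le> d * (\<Sum>m=n..<M. \<Sum>v\<in>H m. p v)"
      using X d by (intro mult_left_mono) auto
    show "d / K0 * (\<Sum>m=n..<M. \<Sum>v\<in>H m. p v * W v) \<le> d * (C / K0)"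
      using mult_left_mono[OF Y, of "d / K0"] d K0(1) by simp
  qed
  also have "\<dots> = (\<Sum>m=n..<M. \<Sum>v\<in>H m. d * p v - d / K0 * (p v * W v))"
    by (simp add: sum_subtractf sum_distrib_left)
  also have "\<dots> \<le> (\<Sum>m=n..<M. \<Sum>v\<in>H m. g v)"
    by (intro sum_mono pointwise)
  also have "\<dots> \<le> (\<Sum>m=n..<M. a m)"
    unfolding a_def
    by (intro sum_mono sum_mono2 finite_inner_level H_inner(1)) (auto simp: inner_level_def intro: g0)
  finally show False using tail[of M] by simp
qed

end

section \<open>Chain trees as probability trees\<close>

lemma rel_mset_sum_eq:
  fixes f :: "'a \<Rightarrow> real"
  assumes "rel_mset R A B" "\<And>a b. R a b \<Longrightarrow> g b = f a"
  shows "(\<Sum>b\<in>#B. g b) = (\<Sum>a\<in>#A. f a)"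
  by (rule antisym; rule rel_mset_sum_le[of R] rel_mset_sum_le[of "R\<inverse>\<inverse>"])
     (use assms in \<open>auto simp: multiset.rel_flip\<close>)

lemma adp_step_prob:
  "adp_step ar D \<alpha> c s \<mu> \<Longrightarrow> (\<Sum>(q, t) \<in># \<mu>. q) = (\<Sum>(p, r) \<in># rhs \<alpha>. p)"
  unfolding adp_step_def by (auto elim!: rel_mset_sum_eq)

lemma sum_mset_children:
  "(\<Sum>(q, t) \<in># {#(a w, b w). w \<in># mset_set S#}. f q t) = (\<Sum>w\<in>S. f (a w) (b w))"
  by (simp add: image_mset.compositionality comp_def sum_unfold_sum_mset)

lemma root_unique:
  assumes "rooted_tree V E r" "rooted_tree V E r'"
  shows "r = r'"
proof -
  have "(r, r') \<in> E\<^sup>*" "\<And>u. (u, r') \<notin> E" using assms by (auto simp: rooted_tree_def)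
  then show ?thesis by (meson rtranclE)
qed

lemma is_CT_root: "is_CT ar D X T used \<Longrightarrow> rooted_tree (nodes T) (edges T) r \<Longrightarrow> prob T r = 1"
  unfolding is_CT_def using root_unique by metis

lemma is_CT_inner:
  assumes "is_CT ar D X T used" "v \<in> nodes T" "children T v \<noteq> {}"
  shows "used v \<in> X" "0 < prob T v" "finite (children T v)" "label T v \<in> sharp_terms ar D"
    "\<exists>c. (v \<in> A_nodes T \<longleftrightarrow> c \<noteq> NT) \<and> adp_step ar D (used v) c (label T v)
      {#(prob T w / prob T v, label T w). w \<in># mset_set (children T v)#}"
proof -
  have "v \<in> inner T" using assms(2,3) by (simp add: inner_def)
  moreover have "c \<in> {AT, AF} \<longleftrightarrow> c \<noteq> NT" for c by (cases c) auto
  ultimately show "used v \<in> X" "0 < prob T v" "finite (children T v)" "label T v \<in> sharp_terms ar D"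
    "\<exists>c. (v \<in> A_nodes T \<longleftrightarrow> c \<noteq> NT) \<and> adp_step ar D (used v) c (label T v)
      {#(prob T w / prob T v, label T w). w \<in># mset_set (children T v)#}"
    using assms(1,2) unfolding is_CT_def by auto
qed

text \<open>The branch probabilities of an ADP sum to 1 and the matching in \<open>adp_step\<close>
  preserves them, so every step conserves mass.\<close>

lemma prob_tree_CT:
  assumes CT: "is_CT ar D X T used" and tree: "rooted_tree (nodes T) (edges T) r"
    and X: "\<And>\<alpha>. \<alpha> \<in> X \<Longrightarrow> (\<Sum>(p, r) \<in># rhs \<alpha>. p) = 1"
  shows "prob_tree (nodes T) (edges T) r (prob T)"
proof
  show "prob T r = 1" using is_CT_root[OF CT tree] .
  fix v assume v: "v \<in> nodes T"
  then show "finite {w. (v, w) \<in> edges T}" "0 < prob T v"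
    using CT unfolding is_CT_def children_def by auto
  show "(\<Sum>w | (v, w) \<in> edges T. prob T w) = prob T v" if "{w. (v, w) \<in> edges T} \<noteq> {}"
  proof -
    have ch: "children T v \<noteq> {}" using that by (simp add: children_def)
    obtain c where "adp_step ar D (used v) c (label T v)
        {#(prob T w / prob T v, label T w). w \<in># mset_set (children T v)#}"
      using is_CT_inner(5)[OF CT v ch] by blast
    from adp_step_prob[OF this] have "(\<Sum>w\<in>children T v. prob T w / prob T v) = 1"
      unfolding sum_mset_children using X is_CT_inner(1)[OF CT v ch] by simp
    then have "(\<Sum>w\<in>children T v. prob T w) / prob T v = 1"
      by (simp add: sum_divide_distrib)
    then show ?thesis
      using \<open>0 < prob T v\<close> by (simp add: children_def)
  qed
qed (rule tree)

lemma leaf_prob_eq_leaf_mass: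
  assumes "prob_tree (nodes T) (edges T) r (prob T)"
  shows "leaf_prob T = prob_tree.leaf_mass (nodes T) (edges T) (prob T)"
  unfolding leaf_prob_def leaves_def children_def prob_tree.leaf_mass_def[OF assms]
    prob_tree.ch_def[OF assms] ..

lemma flat_adp_sel [simp]:
  "lhs (flat_adp \<alpha>) = lhs \<alpha>" "flag (flat_adp \<alpha>) = flag \<alpha>"
  "rhs (flat_adp \<alpha>) = {#(p, flat r). (p, r) \<in># rhs \<alpha>#}"
  by (auto simp: flat_adp_def)

lemma defined_syms_flat: "defined_syms (X \<union> flat_adp ` Y) = defined_syms (X \<union> Y)"
  by (simp add: defined_syms_def bex_Un)

text \<open>Flattening does not touch left-hand sides. Hence the chain trees of both problems are
  built over the same annotated signature.\<close>

lemma defined_syms_RP: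
  "P = P_ge \<union> P_gt \<Longrightarrow> defined_syms ((I \<union> P_gt) \<union> (P_ge \<union> flat_adp ` P_gt)) = defined_syms (I \<union> P)"
  using defined_syms_flat[of "I \<union> P_gt \<union> P_ge" P_gt] by (simp add: Un_ac)

lemma flat_adp_prob: "(\<Sum>(p, r) \<in># rhs (flat_adp \<alpha>). p) = (\<Sum>(p, r) \<in># rhs \<alpha>. p)"
  by (simp add: image_mset.compositionality comp_def case_prod_unfold)

section \<open>Adding annotations\<close>

text \<open>The simulation relation for completeness, both between old and new labels and between
  right-hand sides of \<open>flat_adp \<alpha>\<close> and of \<open>\<alpha>\<close>.\<close>

definition annotates_more :: "'f set \<Rightarrow> ('f, 'v) atrm \<Rightarrow> ('f, 'v) atrm \<Rightarrow> bool" where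
  "annotates_more D s s' \<longleftrightarrow> flat s' = flat s \<and> sharp_poss D s \<subseteq> sharp_poss D s'"

lemma refines_refl: "annotates_more D s s"
  by (simp add: annotates_more_def)

lemma refines_flat: "annotates_more D (flat s) s"
  by (simp add: annotates_more_def sharp_poss_annot)

lemma var_poss_flat: "var_poss (flat r) = var_poss r"
proof (rule set_eqI)
  fix p
  show "p \<in> var_poss (flat r) \<longleftrightarrow> p \<in> var_poss r"
    by (cases "p \<in> poss r"; cases "subt_at r p") (auto simp: var_poss_def subt_at_flat)
qed

lemma is_vrf_flat: "is_vrf l (flat r) \<phi> \<longleftrightarrow> is_vrf l r \<phi>"
  unfolding is_vrf_def var_poss_flat by (fastforce simp: var_poss_def subt_at_flat)

text \<open>Multiset relators commute with composition and converse. The two matchings out of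
  \<open>A\<close> are chained to one from \<open>A'\<close> to \<open>B\<close>, which is then
  factored through a new multiset.\<close>

lemma rel_mset_compose:
  assumes "rel_mset R A B" "rel_mset S A A'"
    and "\<And>a b a'. R a b \<Longrightarrow> S a a' \<Longrightarrow> \<exists>b'. R' a' b' \<and> Q b b'"
  shows "\<exists>B'. rel_mset R' A' B' \<and> rel_mset Q B B'"
proof -
  have "rel_mset (S\<inverse>\<inverse> OO R) A' B"
    using assms(1,2) by (auto simp: multiset.rel_compp multiset.rel_flip)
  then have "rel_mset (R' OO Q\<inverse>\<inverse>) A' B"
    by (rule multiset.rel_mono_strong) (use assms(3) in fastforce)
  then show ?thesis by (auto simp: multiset.rel_compp multiset.rel_flip)
qed

text \<open>Used to hand the branches of a simulating step back to the children of a node, so that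
  the shape of the tree is kept.\<close>

lemma rel_mset_image_mset_set:
  assumes "finite S" "rel_mset Q (image_mset f (mset_set S)) B"
  shows "\<exists>g. B = image_mset g (mset_set S) \<and> (\<forall>w\<in>S. Q (f w) (g w))"
  using assms
proof (induction S arbitrary: B rule: finite_induct)
  case (insert x S)
  then obtain b B' where B: "B = add_mset b B'" "Q (f x) b" "rel_mset Q (image_mset f (mset_set S)) B'"
    by (auto dest: msed_rel_invL)
  then obtain g where g: "B' = image_mset g (mset_set S)" "\<forall>w\<in>S. Q (f w) (g w)"
    using insert.IH by blast
  have "image_mset (g(x := b)) (mset_set S) = image_mset g (mset_set S)"
    by (rule image_mset_cong) (use insert in auto)
  then have "B = image_mset (g(x := b)) (mset_set (insert x S))"
    using insert B g by simp
  moreover have "\<forall>w\<in>insert x S. Q (f w) ((g(x := b)) w)" using insert B g by auto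
  ultimately show ?case by blast
qed auto

lemma sharp_poss_subt_at: "\<pi> \<in> poss s \<Longrightarrow> p \<in> sharp_poss D (subt_at s \<pi>) \<longleftrightarrow> \<pi> @ p \<in> sharp_poss D s"
  by (simp add: sharp_poss_iff poss_append subt_at_append)

text \<open>\<open>Psi\<close> and \<open>Phi\<close> grow with the annotations of the term and of
  the right-hand side, and \<open>AT\<close> keeps all that \<open>NT\<close> keeps.
  \<open>AF\<close> is never exchanged, so both sides erase at the same positions.\<close>

lemma refines_result:
  assumes \<pi>: "\<pi> \<in> poss s" "flat (subt_at s \<pi>) = subst \<sigma> l" and vrf: "is_vrf l r \<phi>"
    and s: "annotates_more D s s'" and r: "annotates_more D r r'"
    and c: "c' = c \<or> c = NT \<and> c' = AT"
  shows "annotates_more D (result c D s \<pi> l \<sigma> r \<phi>) (result c' D s' \<pi> l \<sigma> r' \<phi>)"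
proof -
  have flat: "flat s' = flat s" "flat r' = flat r" using s r by (auto simp: annotates_more_def)
  have \<pi>': "\<pi> \<in> poss s'" using \<pi>(1) flat_eq_poss[OF flat(1)] by simp
  have match': "flat (subt_at s' \<pi>) = subst \<sigma> l"
    using \<pi> \<pi>' flat(1) by (metis subt_at_flat)
  have vrf': "is_vrf l r' \<phi>" using vrf flat(2) is_vrf_flat by metis
  have sub: "sharp_poss D (subt_at s \<pi>) \<subseteq> sharp_poss D (subt_at s' \<pi>)"
    using s \<pi>(1) \<pi>' by (auto simp: annotates_more_def sharp_poss_subt_at)
  have "Psi D l (subt_at s \<pi>) \<phi> \<subseteq> Psi D l (subt_at s' \<pi>) \<phi>"
    using sub by (auto simp: Psi_def)
  then have "new_poss c D l r (subt_at s \<pi>) \<phi> \<subseteq> new_poss c' D l r' (subt_at s' \<pi>) \<phi>"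
    using c r by (auto simp: new_poss_def Phi_def annotates_more_def)
  then show ?thesis
    unfolding annotates_more_def flat_result[OF \<pi>(1)] flat_result[OF \<pi>'] sharp_poss_result[OF \<pi> vrf]
      sharp_poss_result[OF \<pi>' match' vrf'] flat(1) flat_eq_subst[OF flat(2)]
    using s c unfolding annotates_more_def by auto
qed

text \<open>If the redex has become annotated, \<open>NT\<close> must give way to \<open>AT\<close>;
  both require the flag, so the step remains possible.\<close>

lemma adp_step_refines:
  fixes s :: "('f, 'v) atrm"
  assumes step: "adp_step ar D \<beta> c s \<mu>" and s': "annotates_more D s s'" "s' \<in> sharp_terms ar D"
    and eq: "lhs \<alpha> = lhs \<beta>" "flag \<alpha> = flag \<beta>"
    and rel: "rel_mset (\<lambda>(p, r) (q, r'). q = p \<and> annotates_more D r r' \<and> r' \<in> sharp_terms ar D) (rhs \<beta>) (rhs \<alpha>)"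
  shows "\<exists>c' \<mu>'. adp_step ar D \<alpha> c' s' \<mu>' \<and> (c \<noteq> NT \<longrightarrow> c' \<noteq> NT) \<and>
    rel_mset (\<lambda>(q, t) (q', t'). q' = q \<and> annotates_more D t t' \<and> t' \<in> sharp_terms ar D) \<mu> \<mu>'"
proof -
  from step obtain \<sigma> \<pi> where \<sigma>: "is_subst ar \<sigma>" and \<pi>: "\<pi> \<in> defined_poss D s"
    and match: "flat (subt_at s \<pi>) = subst \<sigma> (lhs \<beta>)"
    and c: "case_applies c (\<pi> \<in> sharp_poss D s) (flag \<beta>)"
    and R: "rel_mset (\<lambda>(p, r) (q, t). q = p \<and>
         (\<exists>\<phi>. is_vrf (lhs \<beta>) r \<phi> \<and> t = result c D s \<pi> (lhs \<beta>) \<sigma> r \<phi>)) (rhs \<beta>) \<mu>"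
    unfolding adp_step_def by blast
  define c' where "c' = (if c = NT \<and> \<pi> \<in> sharp_poss D s' then AT else c)"
  have flat: "flat s' = flat s" and sub: "sharp_poss D s \<subseteq> sharp_poss D s'"
    using s'(1) by (auto simp: annotates_more_def)
  have \<pi>s: "\<pi> \<in> poss s" "\<pi> \<in> poss s'" "\<pi> \<in> defined_poss D s'"
    using \<pi> flat_eq_poss[OF flat] flat_eq_defined_poss[OF flat] by (auto simp: defined_poss_iff)
  have match': "flat (subt_at s' \<pi>) = subst \<sigma> (lhs \<beta>)"
    using match \<pi>s flat by (metis subt_at_flat)
  have c': "case_applies c' (\<pi> \<in> sharp_poss D s') (flag \<alpha>)" "c' = c \<or> c = NT \<and> c' = AT"
    using c sub eq by (cases c; auto simp: c'_def)+
  define R' where "R' = (\<lambda>(p :: real, r :: ('f, 'v) atrm) (q, t). q = p \<and>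
         (\<exists>\<phi>. is_vrf (lhs \<alpha>) r \<phi> \<and> t = result c' D s' \<pi> (lhs \<alpha>) \<sigma> r \<phi>))"
  define Q where "Q = (\<lambda>(q :: real, t :: ('f, 'v) atrm) (q', t'). q' = q \<and> annotates_more D t t' \<and> t' \<in> sharp_terms ar D)"
  have branch: "\<exists>b'. R' a' b' \<and> Q b b'"
    if 1: "(\<lambda>(p, r) (q, t). q = p \<and>
         (\<exists>\<phi>. is_vrf (lhs \<beta>) r \<phi> \<and> t = result c D s \<pi> (lhs \<beta>) \<sigma> r \<phi>)) a b"
      and 2: "(\<lambda>(p, r) (q, r'). q = p \<and> annotates_more D r r' \<and> r' \<in> sharp_terms ar D) a a'" for a b a'
  proof -
    obtain p r \<phi> where a: "a = (p, r)" "b = (p, result c D s \<pi> (lhs \<beta>) \<sigma> r \<phi>)" "is_vrf (lhs \<beta>) r \<phi>"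
      using 1 by (cases a; cases b) auto
    obtain r' where a': "a' = (p, r')" "annotates_more D r r'" "r' \<in> sharp_terms ar D"
      using 2 a(1) by (cases a') auto
    have vrf': "is_vrf (lhs \<beta>) r' \<phi>"
      using a(3) a'(2) is_vrf_flat unfolding annotates_more_def by metis
    have "annotates_more D (result c D s \<pi> (lhs \<beta>) \<sigma> r \<phi>) (result c' D s' \<pi> (lhs \<beta>) \<sigma> r' \<phi>)"
      using refines_result[OF \<pi>s(1) match a(3) s'(1) a'(2) c'(2)] .
    moreover have "result c' D s' \<pi> (lhs \<beta>) \<sigma> r' \<phi> \<in> sharp_terms ar D"
      using result_in_sharp_terms[OF \<pi>s(2) match' vrf' s'(2) a'(3) \<sigma>] .
    moreover have "\<exists>\<phi>'. is_vrf (lhs \<alpha>) r' \<phi>' \<and>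
        result c' D s' \<pi> (lhs \<beta>) \<sigma> r' \<phi> = result c' D s' \<pi> (lhs \<alpha>) \<sigma> r' \<phi>'"
      using vrf' unfolding eq(1) by blast
    ultimately show ?thesis
      unfolding a(1,2) a'(1) R'_def Q_def by (intro exI[of _ "(p, result c' D s' \<pi> (lhs \<beta>) \<sigma> r' \<phi>)"]) simp
  qed
  have "\<exists>\<mu>'. rel_mset R' (rhs \<alpha>) \<mu>' \<and> rel_mset Q \<mu> \<mu>'"
    by (rule rel_mset_compose[OF R rel]) (rule branch)
  then obtain \<mu>' where "rel_mset R' (rhs \<alpha>) \<mu>'" and \<mu>': "rel_mset Q \<mu> \<mu>'" by (elim exE conjE)
  then have "adp_step ar D \<alpha> c' s' \<mu>'"
    unfolding adp_step_def R'_def using \<sigma> \<pi>s(3) match' c'(1) eq(1) by auto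
  moreover have "c \<noteq> NT \<longrightarrow> c' \<noteq> NT" using c'(2) by auto
  ultimately show ?thesis using \<mu>' unfolding Q_def by (intro exI conjI)
qed

lemma rel_mset_refines_refl:
  assumes "is_adp ar D \<alpha>"
  shows "rel_mset (\<lambda>(p, r) (q, r'). q = p \<and> annotates_more D r r' \<and> r' \<in> sharp_terms ar D) (rhs \<alpha>) (rhs \<alpha>)"
  by (rule multiset.rel_refl_strong) (use assms in \<open>auto simp: is_adp_def refines_refl\<close>)

lemma rel_mset_refines_flat_adp:
  assumes "is_adp ar D \<alpha>"
  shows "rel_mset (\<lambda>(p, r) (q, r'). q = p \<and> annotates_more D r r' \<and> r' \<in> sharp_terms ar D)
    (rhs (flat_adp \<alpha>)) (rhs \<alpha>)"
  unfolding flat_adp_sel multiset.rel_map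
  by (rule multiset.rel_refl_strong) (use assms in \<open>auto simp: is_adp_def refines_flat\<close>)

text \<open>\<open>Psi\<close> does not depend on the right-hand side, and \<open>annot\<close>
  overwrites the annotations found there.\<close>

lemma adp_step_flat_adp_NT:
  assumes "adp_step ar D \<alpha> NT s \<mu>"
  shows "adp_step ar D (flat_adp \<alpha>) NT s \<mu>"
proof -
  have "annot \<Phi> (subst \<sigma> (flat r)) = annot \<Phi> (subst \<sigma> r)" for \<Phi> \<sigma> and r :: "('a, 'b) atrm"
    using flat_eq_annot flat_subst_flat by blast
  then show ?thesis
    using assms unfolding adp_step_def flat_adp_sel multiset.rel_map
    by (simp add: case_prod_unfold is_vrf_flat)
qed

text \<open>Nodes, edges and probabilities of the given tree are kept; only labels,
  \<open>A_nodes\<close> and the ADPs used are replaced. So both trees have the same leaf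
  probability.\<close>

theorem complete_RP:
  fixes I P P_ge P_gt :: "('f, 'v) adp set"
  assumes problem: "basic_adp_problem ar (I, P)" and P: "P = P_ge \<union> P_gt"
    and bAST: "bAST ar (I, P)"
  shows "bAST ar (I \<union> P_gt, P_ge \<union> flat_adp ` P_gt)"
proof -
  define D where "D = defined_syms (I \<union> P)"
  let ?X = "(I \<union> P_gt) \<union> (P_ge \<union> flat_adp ` P_gt)"
  have DX: "defined_syms ?X = D" using defined_syms_RP[OF P] by (simp add: D_def)
  have adp: "is_adp ar D \<alpha>" if "\<alpha> \<in> I \<union> P" for \<alpha>
    using problem that unfolding basic_adp_problem_def D_def by auto
  have sum1: "(\<Sum>(p, r) \<in># rhs \<alpha>. p) = 1" if "\<alpha> \<in> ?X" for \<alpha>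
  proof -
    obtain \<beta> where "\<beta> \<in> I \<union> P" "\<alpha> = \<beta> \<or> \<alpha> = flat_adp \<beta>" using \<open>\<alpha> \<in> ?X\<close> P by blast
    then show ?thesis using adp[of \<beta>] flat_adp_prob[of \<beta>] by (auto simp: is_adp_def)
  qed
  have "leaf_prob T = 1"
    if CT: "is_CT ar D ?X T used" and tree: "rooted_tree (nodes T) (edges T) r"
      and t: "basic_term ar D t" "label T r = sharp t"
      and fin: "finite {v \<in> inner T. used v \<in> (I \<union> P_gt) - (P_ge \<union> flat_adp ` P_gt)}"
    for T :: "(nat, 'f, 'v) chain_tree" and used r t
  proof -
    interpret T: prob_tree "nodes T" "edges T" r "prob T"
      by (rule prob_tree_CT[OF CT tree sum1])
    have ch: "T.ch v = children T v" for v by (simp add: T.ch_def children_def)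
    \<comment> \<open>A flattened ADP may also lie in \<open>I\<close> or \<open>P_ge\<close>.
      Preferring a preimage in \<open>P_gt\<close> ensures that such a node never counts as a use of
      \<open>I - P\<close>.\<close>
    define used' where "used' v = (if used v \<in> flat_adp ` P_gt
      then (SOME \<alpha>. \<alpha> \<in> P_gt \<and> used v = flat_adp \<alpha>) else used v)" for v
    have used'_flat: "used' v \<in> P_gt" "used v = flat_adp (used' v)" if "used v \<in> flat_adp ` P_gt" for v
    proof -
      have "\<exists>\<alpha>. \<alpha> \<in> P_gt \<and> used v = flat_adp \<alpha>" using that by blast
      from someI_ex[OF this] show "used' v \<in> P_gt" "used v = flat_adp (used' v)"
        using that by (auto simp: used'_def)
    qed
    have used'_other: "used' v = used v" if "used v \<notin> flat_adp ` P_gt" for v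
      using that by (simp add: used'_def)

    have used': "used' v \<in> I \<union> P" if "used v \<in> ?X" for v
      using that used'_flat[of v] used'_other[of v] P by (cases "used v \<in> flat_adp ` P_gt") auto
    define good where "good v s c g \<longleftrightarrow>
      adp_step ar D (used' v) c s {#(prob T w / prob T v, g w). w \<in># mset_set (children T v)#} \<and>
      (v \<in> A_nodes T \<longrightarrow> c \<noteq> NT) \<and>
      (\<forall>w\<in>children T v. annotates_more D (label T w) (g w) \<and> g w \<in> sharp_terms ar D)" for v s c g
    have ex_good: "\<exists>c g. good v s c g"
      if v: "v \<in> nodes T" "children T v \<noteq> {}" and s: "annotates_more D (label T v) s" "s \<in> sharp_terms ar D" for v s
    proof -
      note CTv = is_CT_inner[OF CT v]
      from CTv(5) obtain c where c: "v \<in> A_nodes T \<longleftrightarrow> c \<noteq> NT"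
        and step: "adp_step ar D (used v) c (label T v)
          {#(prob T w / prob T v, label T w). w \<in># mset_set (children T v)#}" by blast
      have adp': "is_adp ar D (used' v)" using adp used' CTv(1) by blast
      have "lhs (used' v) = lhs (used v) \<and> flag (used' v) = flag (used v) \<and>
        rel_mset (\<lambda>(p, r) (q, r'). q = p \<and> annotates_more D r r' \<and> r' \<in> sharp_terms ar D)
          (rhs (used v)) (rhs (used' v))"
      proof (cases "used v \<in> flat_adp ` P_gt")
        case True
        then show ?thesis
          using rel_mset_refines_flat_adp[OF adp'] used'_flat(2)[OF True] by (metis flat_adp_sel(1,2))
      next
        case False
        then show ?thesis
          using rel_mset_refines_refl[OF adp'] used'_other[OF False] by simp
      qed
      then obtain c' \<mu>' where step': "adp_step ar D (used' v) c' s \<mu>'" and c': "c \<noteq> NT \<longrightarrow> c' \<noteq> NT"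
        and rel: "rel_mset (\<lambda>(q, t) (q', t'). q' = q \<and> annotates_more D t t' \<and> t' \<in> sharp_terms ar D)
          {#(prob T w / prob T v, label T w). w \<in># mset_set (children T v)#} \<mu>'"
        using adp_step_refines[OF step s] by blast
      from rel_mset_image_mset_set[OF CTv(3) rel] obtain h where
        h: "\<mu>' = image_mset h (mset_set (children T v))"
        "\<And>w. w \<in> children T v \<Longrightarrow> (\<lambda>(q', t'). q' = prob T w / prob T v \<and>
          annotates_more D (label T w) t' \<and> t' \<in> sharp_terms ar D) (h w)"
        by auto
      have "\<mu>' = {#(prob T w / prob T v, snd (h w)). w \<in># mset_set (children T v)#}"
        unfolding h(1) by (rule image_mset_cong) (use h(2) CTv(3) in fastforce)
      then have "good v s c' (snd \<circ> h)"
        unfolding good_def using step' c c' h(2) by fastforce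
      then show ?thesis by blast
    qed
    \<comment> \<open>The choices may depend on the label \<open>s\<close> that the node has
      received, which is what \<open>tree_recursion\<close> needs.\<close>
    define cc where "cc v s = (SOME c. \<exists>g. good v s c g)" for v s
    define gg where "gg v s = (SOME g. good v s (cc v s) g)" for v s
    have good: "good v s (cc v s) (gg v s)"
      if "v \<in> nodes T" "children T v \<noteq> {}" "annotates_more D (label T v) s" "s \<in> sharp_terms ar D" for v s
      using someI_ex[OF someI_ex[OF ex_good[OF that]]] unfolding gg_def cc_def by simp
    obtain lab where lab: "lab r = label T r" "\<And>v w. (v, w) \<in> edges T \<Longrightarrow> lab w = gg v (lab v) w"
      using T.tree_recursion[of "label T r" gg] by blast
    have inv: "annotates_more D (label T v) (lab v) \<and> lab v \<in> sharp_terms ar D" if "v \<in> T.level n" for v n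
      using that
    proof (induction n arbitrary: v)
      case 0
      then have "v = r" "v \<in> nodes T" using T.level_subset[of 0] by (auto simp: T.level_0)
      then show ?case using lab(1) CT by (auto simp: refines_refl is_CT_def)
    next
      case (Suc n)
      then obtain u where u: "u \<in> T.level n" "v \<in> children T u" by (auto simp: T.level_Suc ch)
      then have "u \<in> nodes T" "children T u \<noteq> {}" using T.level_subset by auto
      then have "good u (lab u) (cc u (lab u)) (gg u (lab u))"
        using good Suc.IH[OF u(1)] by blast
      moreover have "lab v = gg u (lab u) v" using lab(2) u(2) by (simp add: children_def)
      ultimately show ?case using u(2) by (simp add: good_def)
    qed
    then have inv: "annotates_more D (label T v) (lab v)" "lab v \<in> sharp_terms ar D" if "v \<in> nodes T" for v
      using that T.nodes_eq_levels by blast+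

    define T' where "T' = T\<lparr>label := lab, A_nodes := {v \<in> inner T. cc v (lab v) \<noteq> NT}\<rparr>"
    have T': "nodes T' = nodes T" "edges T' = edges T" "prob T' = prob T" "label T' = lab"
      "A_nodes T' = {v \<in> inner T. cc v (lab v) \<noteq> NT}"
      "children T' = children T" "inner T' = inner T" "leaves T' = leaves T"
      by (auto simp: T'_def children_def inner_def leaves_def fun_eq_iff)
    have good': "good v (lab v) (cc v (lab v)) (gg v (lab v))" if "v \<in> inner T" for v
      using that good inv by (auto simp: inner_def)
    \<comment> \<open>This carries the condition on infinite paths over to
      \<open>T'\<close>.\<close>
    have A: "A_nodes T \<subseteq> A_nodes T'"
      using CT good' unfolding T' is_CT_def good_def by auto
    have "is_CT ar D (I \<union> P) T' used'"
      unfolding is_CT_def T'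
    proof (intro conjI ballI)
      show "\<exists>r. rooted_tree (nodes T) (edges T) r \<and> prob T r = 1"
        using T.tree T.prob_root by blast
      fix v
      show "finite (children T v)" "0 < prob T v" "prob T v \<le> 1" "lab v \<in> sharp_terms ar D"
        if "v \<in> nodes T"
        using that CT inv unfolding is_CT_def by auto
      assume v: "v \<in> inner T"
      show "used' v \<in> I \<union> P" using v CT used' unfolding is_CT_def by auto
      have "{#(prob T w / prob T v, gg v (lab v) w). w \<in># mset_set (children T v)#} =
          {#(prob T w / prob T v, lab w). w \<in># mset_set (children T v)#}"
      proof (rule image_mset_cong)
        fix w assume "w \<in># mset_set (children T v)"
        then have "w \<in> children T v" by (metis elem_mset_set infinite_set_mset_mset_set equals0D)
        then show "(prob T w / prob T v, gg v (lab v) w) = (prob T w / prob T v, lab w)"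
          using lab(2) by (simp add: children_def)
      qed
      moreover have "c \<in> {AT, AF} \<longleftrightarrow> c \<noteq> NT" for c by (cases c) auto
      ultimately show "\<exists>c. (v \<in> {v \<in> inner T. cc v (lab v) \<noteq> NT} \<longleftrightarrow> c \<in> {AT, AF}) \<and>
         adp_step ar D (used' v) c (lab v) {#(prob T w / prob T v, lab w). w \<in># mset_set (children T v)#}"
        using good'[OF v] v unfolding good_def by (intro exI[of _ "cc v (lab v)"]) auto
    next
      show "\<forall>x. (\<forall>i. (x i, x (Suc i)) \<in> edges T) \<longrightarrow>
          infinite {i. x i \<in> {v \<in> inner T. cc v (lab v) \<noteq> NT}}"
      proof (intro allI impI)
        fix x :: "nat \<Rightarrow> nat" assume "\<forall>i. (x i, x (Suc i)) \<in> edges T"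
        then have "infinite {i. x i \<in> A_nodes T}" using CT unfolding is_CT_def by blast
        moreover have "{i. x i \<in> A_nodes T} \<subseteq> {i. x i \<in> {v \<in> inner T. cc v (lab v) \<noteq> NT}}"
          using A unfolding T' by blast
        ultimately show "infinite {i. x i \<in> {v \<in> inner T. cc v (lab v) \<noteq> NT}}"
          using infinite_super by blast
      qed
    qed auto
    moreover have "finite {v \<in> inner T'. used' v \<in> I - P}"
    proof (rule finite_subset[OF _ fin])
      show "{v \<in> inner T'. used' v \<in> I - P} \<subseteq>
        {v \<in> inner T. used v \<in> (I \<union> P_gt) - (P_ge \<union> flat_adp ` P_gt)}"
      proof
        fix v assume v: "v \<in> {v \<in> inner T'. used' v \<in> I - P}"
        then have "used v \<notin> flat_adp ` P_gt" using used'_flat(1)[of v] P by auto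
        then show "v \<in> {v \<in> inner T. used v \<in> (I \<union> P_gt) - (P_ge \<union> flat_adp ` P_gt)}"
          using v used'_other[of v] P by (simp add: T')
      qed
    qed
    ultimately have "leaf_prob T' = 1"
      using bAST tree t lab(1) unfolding bAST_def D_def[symmetric] by (auto simp: Let_def D_def T')
    then show ?thesis by (simp add: leaf_prob_def T')
  qed
  then show ?thesis unfolding bAST_def by (simp add: Let_def DX)
qed

section \<open>Cutting chain trees\<close>

text \<open>\<open>K\<close> is taken out of \<open>A_nodes\<close> because its nodes become leaves,
  and only inner nodes may belong to \<open>A_nodes\<close>.\<close>

definition cut_CT :: "('n, 'f, 'v) chain_tree \<Rightarrow> 'n \<Rightarrow> 'n set \<Rightarrow> ('n, 'f, 'v) chain_tree" where
  "cut_CT T r K = T\<lparr>nodes := cut_nodes (edges T) r K, edges := cut_edges (edges T) r K,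
    A_nodes := A_nodes T \<inter> (cut_nodes (edges T) r K - K)\<rparr>"

lemma children_cut_CT:
  "v \<in> nodes (cut_CT T r K) \<Longrightarrow> children (cut_CT T r K) v = (if v \<in> K then {} else children T v)"
  unfolding children_def cut_CT_def using cut_children[of v "edges T" r K] by simp

lemma inner_cut_CT:
  assumes "rooted_tree (nodes T) (edges T) r" "v \<in> inner (cut_CT T r K)"
  shows "v \<in> inner T" "v \<notin> K" "v \<in> nodes (cut_CT T r K)" "children (cut_CT T r K) v = children T v"
proof -
  show 1: "v \<in> nodes (cut_CT T r K)" using assms(2) by (simp add: inner_def)
  have "children (cut_CT T r K) v \<noteq> {}" using assms(2) by (simp add: inner_def)
  then show 2: "v \<notin> K" "children (cut_CT T r K) v = children T v"
    using children_cut_CT[OF 1] by (auto split: if_splits)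
  show "v \<in> inner T"
    using 1 2 cut_nodes_subset[OF assms(1), of K] \<open>children (cut_CT T r K) v \<noteq> {}\<close>
    by (auto simp: inner_def cut_CT_def)
qed

text \<open>
  A step with \<open>NT\<close> ignores the annotations of the ADP, so it may as well use \<open>flat_adp\<close>.
\<close>

lemma is_CT_cut:
  fixes T :: "('n, 'f, 'v) chain_tree"
  assumes CT: "is_CT ar D X T used" and tree: "rooted_tree (nodes T) (edges T) r"
    and Y: "\<And>v. v \<in> inner T \<Longrightarrow> v \<notin> K \<Longrightarrow> used' v \<in> Y"
    and used': "\<And>v. used' v = used v \<or> v \<notin> A_nodes T \<and> used' v = flat_adp (used v)"
  shows "is_CT ar D Y (cut_CT T r K) used'"
proof -
  let ?T = "cut_CT T r K"
  have sel: "nodes ?T = cut_nodes (edges T) r K" "edges ?T = cut_edges (edges T) r K"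
    "prob ?T = prob T" "label ?T = label T" "A_nodes ?T = A_nodes T \<inter> (cut_nodes (edges T) r K - K)"
    by (simp_all add: cut_CT_def)
  have sub: "nodes ?T \<subseteq> nodes T" using cut_nodes_subset[OF tree] by (simp add: sel)
  note inn = inner_cut_CT[OF tree, where K = K]
  show ?thesis
    unfolding is_CT_def
  proof (intro conjI ballI)
    show "\<exists>r. rooted_tree (nodes ?T) (edges ?T) r \<and> prob ?T r = 1"
      using rooted_tree_cut[OF tree, of K] is_CT_root[OF CT tree] by (auto simp: sel)
    show "A_nodes ?T \<subseteq> inner ?T"
    proof
      fix v assume v: "v \<in> A_nodes ?T"
      then have "v \<in> inner T" using CT by (auto simp: is_CT_def sel)
      then show "v \<in> inner ?T"
        using v children_cut_CT[of v T r K] by (auto simp: sel inner_def)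
    qed
    fix v
    show "finite (children ?T v)" "0 < prob ?T v" "prob ?T v \<le> 1" "label ?T v \<in> sharp_terms ar D"
      if v: "v \<in> nodes ?T"
      using v sub CT children_cut_CT[OF v] by (auto simp: is_CT_def sel(3,4))
    assume v: "v \<in> inner ?T"
    note v' = inn[OF v]
    show "used' v \<in> Y" using Y v' by blast
    have A: "v \<in> A_nodes ?T \<longleftrightarrow> v \<in> A_nodes T" using v'(2,3) by (simp add: sel)
    obtain c where c: "v \<in> A_nodes T \<longleftrightarrow> c \<in> {AT, AF}"
      and step: "adp_step ar D (used v) c (label T v)
        {#(prob T w / prob T v, label T w). w \<in># mset_set (children T v)#}"
      using CT v'(1) unfolding is_CT_def by blast
    have "adp_step ar D (used' v) c (label T v)
        {#(prob T w / prob T v, label T w). w \<in># mset_set (children T v)#}"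
    proof (cases "used' v = used v")
      case True
      then show ?thesis using step by simp
    next
      case False
      then have *: "v \<notin> A_nodes T" "used' v = flat_adp (used v)" using used'[of v] by auto
      then have "c = NT" using c by (cases c) auto
      then show ?thesis using step adp_step_flat_adp_NT unfolding *(2) by blast
    qed
    then show "\<exists>c. (v \<in> A_nodes ?T \<longleftrightarrow> c \<in> {AT, AF}) \<and> adp_step ar D (used' v) c (label ?T v)
        {#(prob ?T w / prob ?T v, label ?T w). w \<in># mset_set (children ?T v)#}"
      using c unfolding A v'(4) sel(3,4) by blast
  next
    show "\<forall>x. (\<forall>i. (x i, x (Suc i)) \<in> edges ?T) \<longrightarrow> infinite {i. x i \<in> A_nodes ?T}"
    proof (intro allI impI)
      fix x :: "nat \<Rightarrow> 'n" assume x: "\<forall>i. (x i, x (Suc i)) \<in> edges ?T"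
      \<comment> \<open>An infinite path never visits \<open>K\<close>, whose nodes have no outgoing
        edges left, so it meets the same nodes of \<open>A_nodes\<close> as before.\<close>
      then have "\<forall>i. (x i, x (Suc i)) \<in> edges T" "\<And>i. x i \<in> cut_nodes (edges T) r K - K"
        by (auto simp: sel cut_edges_def)
      moreover from this(1) have "infinite {i. x i \<in> A_nodes T}" using CT unfolding is_CT_def by blast
      ultimately show "infinite {i. x i \<in> A_nodes ?T}" by (simp add: sel)
    qed
  qed
qed

text \<open>An instance of \<open>leaf_mass_eq_1\<close>, with the weight of the labels as
  \<open>W\<close> and the annotated steps with \<open>P_gt\<close> as \<open>A\<close>; its
  hypothesis \<open>cut\<close> is where \<open>bAST\<close> of the new problem enters.\<close>

theorem sound_RP:
  fixes ar :: "'f \<Rightarrow> nat" and Pol :: "'f sym \<Rightarrow> nat mpoly"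
    and I P P_ge P_gt :: "('f, 'v) adp set" and D :: "'f set"
  defines "D \<equiv> defined_syms (I \<union> P)"
  assumes problem: "basic_adp_problem ar (I, P)"
    and interp: "poly_interp ar D Pol" "multilinear D Pol"
    and P: "P = P_ge \<union> P_gt"
    and sharp_le: "\<And>\<alpha> \<rho> :: 'v \<Rightarrow> nat. \<alpha> \<in> P \<Longrightarrow>
      (\<Sum>(p, r) \<in># rhs \<alpha>. p * real (peval (Sum_pol D Pol r) \<rho>)) \<le>
        real (peval (pol Pol (sharp (lhs \<alpha>))) \<rho>)"
    and strict: "\<And>\<alpha>. \<alpha> \<in> P_gt \<Longrightarrow> \<exists>(p, r) \<in># rhs \<alpha>.
      (\<forall>\<rho> :: 'v \<Rightarrow> nat. peval (Sum_pol D Pol r) \<rho> < peval (pol Pol (sharp (lhs \<alpha>))) \<rho>) \<and>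
      (flag \<alpha> \<longrightarrow> (\<forall>\<rho> :: 'v \<Rightarrow> nat. peval (pol Pol (flat r)) \<rho> \<le> peval (pol Pol (lhs \<alpha>)) \<rho>))"
    and flat_le: "\<And>\<alpha> \<rho> :: 'v \<Rightarrow> nat. \<alpha> \<in> P \<Longrightarrow> flag \<alpha> \<Longrightarrow>
      (\<Sum>(p, r) \<in># rhs \<alpha>. p * real (peval (pol Pol (flat r)) \<rho>)) \<le> real (peval (pol Pol (lhs \<alpha>)) \<rho>)"
    and bAST: "bAST ar (I \<union> P_gt, P_ge \<union> flat_adp ` P_gt)"
  shows "bAST ar (I, P)"
proof -
  interpret multilinear_interp ar D Pol
    by unfold_locales (fact interp)+
  have adp: "is_adp ar D \<alpha>" if "\<alpha> \<in> I \<union> P" for \<alpha>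
    using problem that unfolding basic_adp_problem_def D_def by auto
  then have sum1: "(\<Sum>(p, r) \<in># rhs \<alpha>. p) = 1" if "\<alpha> \<in> I \<union> P" for \<alpha>
    using that by (auto simp: is_adp_def)
  let ?Y = "(I \<union> P_gt) \<union> (P_ge \<union> flat_adp ` P_gt)"
  have DY: "defined_syms ?Y = D" using defined_syms_RP[OF P] by (simp add: D_def)

  define S where "S = (\<Union>\<alpha>\<in>P_gt. fst ` set_mset (rhs \<alpha>))"
  \<comment> \<open>A uniform lower bound for the branch that decreases; inserting 1 keeps the set
    nonempty for \<open>Min\<close>.\<close>
  define c where "c = Min (insert 1 S)"
  have "finite P_gt" using problem P by (simp add: basic_adp_problem_def)
  then have finS: "finite S" by (simp add: S_def)
  have "0 < p" if pS: "p \<in> S" for p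
  proof -
    obtain \<alpha> s where "\<alpha> \<in> P_gt" "(p, s) \<in># rhs \<alpha>" using pS by (auto simp: S_def)
    then show ?thesis using adp[of \<alpha>] P by (auto simp: is_adp_def)
  qed
  then have c: "0 < c" using finS by (auto simp: c_def)
  have c_le: "c \<le> p" if "\<alpha> \<in> P_gt" "(p, r) \<in># rhs \<alpha>" for \<alpha> p r
  proof -
    have "p \<in> S" using that by (force simp: S_def)
    then show ?thesis using finS by (simp add: c_def)
  qed

  have "leaf_prob T = 1"
    if CT: "is_CT ar D (I \<union> P) T used" and tree: "rooted_tree (nodes T) (edges T) r"
      and t: "basic_term ar D t" "label T r = sharp t"
      and fin: "finite {v \<in> inner T. used v \<in> I - P}"
    for T :: "(nat, 'f, 'v) chain_tree" and used r t
  proof -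
    interpret T: prob_tree "nodes T" "edges T" r "prob T"
      by (rule prob_tree_CT[OF CT tree sum1])
    have ch: "T.ch v = children T v" for v by (simp add: T.ch_def children_def)
    define B where "B = {v \<in> inner T. used v \<in> I - P}"
    have "\<forall>v\<in>B. \<exists>m. v \<in> T.level m"
      using T.nodes_eq_levels by (auto simp: B_def inner_def)
    then obtain d where d: "\<forall>v\<in>B. v \<in> T.level (d v)" by (rule bchoice[elim_format]) blast
    \<comment> \<open>Exceeds the depth of every node of the finite set \<open>B\<close>; the sum
      serves as a bound for the maximum.\<close>
    define N where "N = Suc (\<Sum>v\<in>B. d v)"
    have used_P: "used v \<in> P" if m: "N \<le> m" and v: "v \<in> T.inner_level m" for m v
    proof (rule ccontr)
      assume "used v \<notin> P"
      have vT: "v \<in> inner T" "v \<in> T.level m"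
        using v T.level_subset[of m] by (auto simp: T.inner_level_def inner_def ch)
      then have "used v \<in> I \<union> P" using CT by (auto simp: is_CT_def)
      then have "v \<in> B" using vT \<open>used v \<notin> P\<close> by (simp add: B_def)
      then have "d v = m" "d v \<le> (\<Sum>v\<in>B. d v)"
        using d vT T.level_disjoint fin by (auto simp: B_def intro!: member_le_sum)
      then show False using m by (simp add: N_def)
    qed
    define A where "A = {v \<in> inner T. used v \<in> P_gt \<and> v \<in> A_nodes T}"
    define W where "W v = real (weight (label T v))" for v

    have "T.leaf_mass = 1"
    proof (rule T.leaf_mass_eq_1)
      show "0 \<le> W v" for v by (simp add: W_def)
      show "0 < c" by (rule c)
      show "T.ch v \<noteq> {}" if "v \<in> A" for v
        using that by (simp add: A_def inner_def ch)
    next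
      fix m v assume m: "N \<le> m" and v: "v \<in> T.inner_level m"
      have v': "v \<in> nodes T" "children T v \<noteq> {}"
        using v T.level_subset[of m] by (auto simp: T.inner_level_def ch)
      note CTv = is_CT_inner[OF CT v']
      have \<alpha>: "used v \<in> P" "is_adp ar D (used v)" using used_P[OF m v] adp by auto
      obtain k where k: "v \<in> A_nodes T \<longleftrightarrow> k \<noteq> NT" and step: "adp_step ar D (used v) k (label T v)
          {#(prob T w / prob T v, label T w). w \<in># mset_set (children T v)#}"
        using CTv(5) by blast
      have "(\<Sum>w\<in>children T v. prob T w / prob T v * W w) \<le> W v"
        using weight_step_le[OF \<alpha>(2) step CTv(4) sharp_le[OF \<alpha>(1)] flat_le[OF \<alpha>(1)]]
        by (simp add: sum_mset_children W_def)
      then have "prob T v * (\<Sum>w\<in>children T v. prob T w / prob T v * W w) \<le> prob T v * W v"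
        using CTv(2) by simp
      moreover have "prob T v * (\<Sum>w\<in>children T v. prob T w / prob T v * W w) =
          (\<Sum>w\<in>children T v. prob T w * W w)"
        unfolding sum_distrib_left by (rule sum.cong) (use CTv(2) in auto)
      ultimately show "(\<Sum>w\<in>T.ch v. prob T w * W w) \<le> prob T v * W v" by (simp add: ch)

      assume "v \<in> A"
      then have gt: "used v \<in> P_gt" "k \<noteq> NT" using k by (auto simp: A_def)
      obtain p s where ps: "(p, s) \<in># rhs (used v)"
        "\<And>\<rho> :: 'v \<Rightarrow> nat. peval (Sum_pol D Pol s) \<rho> < peval (pol Pol (sharp (lhs (used v)))) \<rho>"
        "\<And>\<rho> :: 'v \<Rightarrow> nat. flag (used v) \<Longrightarrow> peval (pol Pol (flat s)) \<rho> \<le> peval (pol Pol (lhs (used v))) \<rho>"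
        using strict[OF gt(1)] by blast
      from weight_step_decrease[OF \<alpha>(2) step CTv(4) gt(2) ps(1,2,3)]
      obtain w where w: "w \<in> children T v" "p = prob T w / prob T v"
        "weight (label T w) < weight (label T v)"
        using CTv(3) by auto
      have "c * prob T v \<le> prob T w"
        using c_le[OF gt(1) ps(1)] w(2) CTv(2) by (simp add: le_divide_eq)
      moreover have "W w + 1 \<le> W v" using w(3) by (simp add: W_def)
      ultimately show "\<exists>w\<in>T.ch v. c * prob T v \<le> prob T w \<and> W w + 1 \<le> W v"
        using w(1) by (auto simp: ch)
    next
      fix n K assume n: "N \<le> n" and K: "K = A \<inter> (\<Union>m\<in>{n..}. T.level m)"
      \<comment> \<open>Only steps at unannotated positions may switch to the flattened ADP; the
        others make use of its annotations.\<close>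
      define used' where "used' v = (if used v \<in> P_gt \<and> v \<notin> A_nodes T then flat_adp (used v) else used v)" for v
      let ?T = "cut_CT T r K"
      have "is_CT ar D ?Y ?T used'"
      proof (rule is_CT_cut[OF CT tree])
        show "used' v \<in> ?Y" if "v \<in> inner T" for v
        proof -
          have "used v \<in> I \<union> P" using that CT by (auto simp: is_CT_def)
          then show ?thesis using P by (auto simp: used'_def)
        qed
      qed (simp add: used'_def)
      moreover have tree': "rooted_tree (nodes ?T) (edges ?T) r"
        using rooted_tree_cut[OF tree] by (simp add: cut_CT_def)
      moreover have "finite {v \<in> inner ?T. used' v \<in> (I \<union> P_gt) - (P_ge \<union> flat_adp ` P_gt)}"
      proof (rule finite_subset)
        \<comment> \<open>The original \<open>P_gt\<close> is still used only at annotated positions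
          above depth \<open>n\<close>, because deeper such nodes belong to \<open>K\<close> and are
          leaves now.\<close>
        show "finite (B \<union> (\<Union>m<n. T.level m))" using fin T.finite_level by (simp add: B_def)
        show "{v \<in> inner ?T. used' v \<in> (I \<union> P_gt) - (P_ge \<union> flat_adp ` P_gt)} \<subseteq> B \<union> (\<Union>m<n. T.level m)"
        proof
          fix v assume v: "v \<in> {v \<in> inner ?T. used' v \<in> (I \<union> P_gt) - (P_ge \<union> flat_adp ` P_gt)}"
          then have vT: "v \<in> inner T" "v \<notin> K" using inner_cut_CT[OF tree] by blast+
          show "v \<in> B \<union> (\<Union>m<n. T.level m)"
          proof (cases "used v \<in> P_gt")
            case True
            then have "v \<in> A_nodes T" using v by (auto simp: used'_def split: if_splits)
            then have "v \<in> A" using True vT(1) by (simp add: A_def)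
            moreover obtain m where "v \<in> T.level m"
              using vT(1) T.nodes_eq_levels by (auto simp: inner_def)
            ultimately have "m < n" using vT(2) K by (auto simp: not_less[symmetric])
            then show ?thesis using \<open>v \<in> T.level m\<close> by blast
          next
            case False
            then have "used v \<in> I - P" using v P by (auto simp: used'_def)
            then show ?thesis using vT(1) by (simp add: B_def)
          qed
        qed
      qed
      moreover have "label ?T r = sharp t" using t(2) by (simp add: cut_CT_def)
      ultimately have "leaf_prob ?T = 1"
        using bAST t(1) DY unfolding bAST_def Let_def prod.case by blast
      moreover have "prob_tree (nodes ?T) (edges ?T) r (prob ?T)"
        using T.prob_tree_cut[of K] by (simp add: cut_CT_def)
      ultimately show "prob_tree.leaf_mass (cut_nodes (edges T) r K) (cut_edges (edges T) r K) (prob T) = 1"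
        using leaf_prob_eq_leaf_mass[of ?T r] by (simp add: cut_CT_def)
    qed
    then show ?thesis
      using leaf_prob_eq_leaf_mass[OF T.prob_tree_axioms] by simp
  qed
  then show ?thesis unfolding bAST_def by (simp add: Let_def D_def[symmetric])
qed

theorem theorem39:
  fixes ar :: "'f::finite \<Rightarrow> nat"
    and Pol :: "'f sym \<Rightarrow> nat mpoly"
    and I P P_ge P_gt :: "('f, 'v) adp set"
    and D :: "'f set"
  defines "D \<equiv> defined_syms (I \<union> P)"
  assumes problem: "basic_adp_problem ar (I, P)"
    and interp: "poly_interp ar D Pol" "multilinear D Pol"
    and partition: "P = P_ge \<union> P_gt" "P_ge \<inter> P_gt = {}" "P_gt \<noteq> {}"
    and cond1: "\<forall>\<alpha>\<in>P. \<forall>\<rho> :: 'v \<Rightarrow> nat.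
      real (peval (pol Pol (sharp (lhs \<alpha>))) \<rho>) \<ge>
        (\<Sum>(p, r) \<in># rhs \<alpha>. p * real (peval (Sum_pol D Pol r) \<rho>))"
    and cond2: "\<forall>\<alpha>\<in>P_gt. \<exists>(p, r) \<in># rhs \<alpha>.
      (\<forall>\<rho> :: 'v \<Rightarrow> nat. peval (pol Pol (sharp (lhs \<alpha>))) \<rho> > peval (Sum_pol D Pol r) \<rho>) \<and>
      (flag \<alpha> \<longrightarrow>
        (\<forall>\<rho> :: 'v \<Rightarrow> nat. peval (pol Pol (lhs \<alpha>)) \<rho> \<ge> peval (pol Pol (flat r)) \<rho>))"
    and cond3: "\<forall>\<alpha>\<in>P. flag \<alpha> \<longrightarrow> (\<forall>\<rho> :: 'v \<Rightarrow> nat.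
      real (peval (pol Pol (lhs \<alpha>)) \<rho>) \<ge>
        (\<Sum>(p, r) \<in># rhs \<alpha>. p * real (peval (pol Pol (flat r)) \<rho>)))"
  shows "sound_bAST ar (I, P) (proc_RP I P_ge P_gt) \<and>
    complete_bAST ar (I, P) (proc_RP I P_ge P_gt)"
  unfolding sound_complete_proc_RP_iff
proof
  show "bAST ar (I, P)" if "bAST ar (I \<union> P_gt, P_ge \<union> flat_adp ` P_gt)"
    by (rule sound_RP[OF problem interp[unfolded D_def] partition(1)])
       (use cond1 cond2 cond3 that in \<open>auto simp: D_def\<close>)
qed (rule complete_RP[OF problem partition(1)])

end
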